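(* Let $\beta\in(0,\infty)^n$ and $\alpha\ge0$. Then $\mathrm{CMO}^{\beta,\alpha}\supset\mathrm{VMO}^{\beta,\alpha}$ as spaces of functions on $\mathbb{R}^n$.
   Context: All functions are complex valued and locally integrable on $\mathbb{R}^n$. Denote $|\beta|=\sum_j\beta_j$. A $\beta$-cube is a rectangle $Q=I_1\times\cdots\times I_n$ parallel to the coordinate axes with $\ell(Q):=\ell(I_1)^{1/\beta_1}=\cdots=\ell(I_n)^{1/\beta_n}$, where $\ell(I_j)$ is the length of $I_j$; their collection is $\mathcal{R}^\beta$. Put $\mathcal{O}^{\alpha}(b;Q)=|Q|^{-\alpha/|\beta|}\frac1{|Q|}\int_Q|b-\langle b\rangle_Q|$ with $\langle b\rangle_Q=\frac1{|Q|}\int_Q b$, and $\|b\|_{\mathrm{BMO}^{\beta,\alpha}}=\sup_{Q\in\mathcal{R}^\beta}\mathcal{O}^{\alpha}(b;Q)$; $\mathrm{BMO}^{\beta,\alpha}$ consists of the $b$ for which this is finite. $\mathrm{VMO}^{\beta,\alpha}$ consists of those $b\in\mathrm{BMO}^{\beta,\alpha}$ that satisfy all three conditions $$\lim_{r\to0}\sup_{Q\in\mathcal{R}^\beta,\ \ell(Q)\le r}\mathcal{O}^{\alpha}(b;Q)=0,\quad \lim_{r\to\infty}\sup_{Q\in\mathcal{R}^\beta,\ \ell(Q)\ge r}\mathcal{O}^{\alpha}(b;Q)=0,\quad \sup_{Q\in\mathcal{R}^\beta}\lim_{|x|\to\infty}\mathcal{O}^{\alpha}(b;Q+x)=0.$$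 $\mathrm{CMO}^{\beta,\alpha}$ is the closure of $C^\infty_c$ in $\mathrm{BMO}^{\beta,\alpha}$: the set of $f\in\mathrm{BMO}^{\beta,\alpha}$ for which there exist $g_j\in C^\infty_c(\mathbb{R}^n)$ with $\lim_{j\to\infty}\|f-g_j\|_{\mathrm{BMO}^{\beta,\alpha}}=0$. *)

theory Defs
  imports "HOL-Analysis.Analysis"
begin

definition locally_integrable :: "(real ^ 'n \<Rightarrow> complex) \<Rightarrow> bool" where
  "locally_integrable b \<longleftrightarrow> (\<forall>K. compact K \<longrightarrow> b absolutely_integrable_on K)"

text \<open>Cubes are taken to be closed; since boundaries of rectangles are null sets, this choice
  does not affect any of the averages below.\<close>

definition beta_cubes :: "real ^ 'n \<Rightarrow> (real ^ 'n) set set" where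
  "beta_cubes \<beta> = {cbox a b | a b. (\<forall>i. a $ i < b $ i) \<and>
      (\<forall>i j. (b $ i - a $ i) powr (1 / \<beta> $ i) = (b $ j - a $ j) powr (1 / \<beta> $ j))}"

definition side :: "real ^ 'n \<Rightarrow> (real ^ 'n) set \<Rightarrow> real" where
  "side \<beta> Q = (THE l. \<exists>a b. Q = cbox a b \<and> (\<forall>i. a $ i < b $ i) \<and>
      (\<forall>i. l = (b $ i - a $ i) powr (1 / \<beta> $ i)))"

lemma side_cbox:
  fixes a b \<beta> :: "real ^ 'n"
  assumes "\<And>i. a $ i < b $ i"
    and "\<And>i j. (b $ i - a $ i) powr (1 / \<beta> $ i) = (b $ j - a $ j) powr (1 / \<beta> $ j)"
  shows "side \<beta> (cbox a b) = (b $ k - a $ k) powr (1 / \<beta> $ k)"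
  unfolding side_def
proof (rule the_equality)
  show "\<exists>a' b'. cbox a b = cbox a' b' \<and> (\<forall>i. a' $ i < b' $ i) \<and>
      (\<forall>i. (b $ k - a $ k) powr (1 / \<beta> $ k) = (b' $ i - a' $ i) powr (1 / \<beta> $ i))"
    using assms by blast
next
  fix l
  assume "\<exists>a' b'. cbox a b = cbox a' b' \<and> (\<forall>i. a' $ i < b' $ i) \<and>
      (\<forall>i. l = (b' $ i - a' $ i) powr (1 / \<beta> $ i))"
  then obtain a' b' where eq: "cbox a b = cbox a' b'"
    and l: "\<forall>i. l = (b' $ i - a' $ i) powr (1 / \<beta> $ i)" by blast
  have "cbox a b \<noteq> {}"
    using assms(1) by (simp add: interval_ne_empty_cart less_imp_le)
  with eq have "a = a'" "b = b'"
    by (simp_all add: eq_cbox)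
  with l show "l = (b $ k - a $ k) powr (1 / \<beta> $ k)" by blast
qed

definition average :: "(real ^ 'n \<Rightarrow> complex) \<Rightarrow> (real ^ 'n) set \<Rightarrow> complex" where
  "average b Q = (LINT y:Q|lebesgue. b y) /\<^sub>R measure lebesgue Q"

definition osc ::
    "real ^ 'n \<Rightarrow> real \<Rightarrow> (real ^ 'n \<Rightarrow> complex) \<Rightarrow> (real ^ 'n) set \<Rightarrow> real" where
  "osc \<beta> \<alpha> b Q = measure lebesgue Q powr (- \<alpha> / (\<Sum>j\<in>UNIV. \<beta> $ j)) *
      (1 / measure lebesgue Q * (LINT y:Q|lebesgue. cmod (b y - average b Q)))"

text \<open>Suprema and limits of oscillations are taken in \<^typ>\<open>ennreal\<close>, since the suprema may
  be infinite.\<close>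

definition bmo_norm :: "real ^ 'n \<Rightarrow> real \<Rightarrow> (real ^ 'n \<Rightarrow> complex) \<Rightarrow> ennreal" where
  "bmo_norm \<beta> \<alpha> b = (SUP Q\<in>beta_cubes \<beta>. ennreal (osc \<beta> \<alpha> b Q))"

definition BMO :: "real ^ 'n \<Rightarrow> real \<Rightarrow> (real ^ 'n \<Rightarrow> complex) set" where
  "BMO \<beta> \<alpha> = {b. locally_integrable b \<and> bmo_norm \<beta> \<alpha> b < \<infinity>}"

text \<open>In the last condition, \<open>L Q\<close> is the limit of the oscillations over the translates of
  \<open>Q\<close>; its existence for every \<open>Q\<close> is part of the condition.\<close>

definition VMO :: "real ^ 'n \<Rightarrow> real \<Rightarrow> (real ^ 'n \<Rightarrow> complex) set" where
  "VMO \<beta> \<alpha> = {b \<in> BMO \<beta> \<alpha>.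
     ((\<lambda>r. SUP Q\<in>{Q \<in> beta_cubes \<beta>. side \<beta> Q \<le> r}. ennreal (osc \<beta> \<alpha> b Q)) \<longlongrightarrow> 0) (at_right 0) \<and>
     ((\<lambda>r. SUP Q\<in>{Q \<in> beta_cubes \<beta>. side \<beta> Q \<ge> r}. ennreal (osc \<beta> \<alpha> b Q)) \<longlongrightarrow> 0) at_top \<and>
     (\<exists>L. (\<forall>Q\<in>beta_cubes \<beta>.
              ((\<lambda>x. ennreal (osc \<beta> \<alpha> b ((\<lambda>y. y + x) ` Q))) \<longlongrightarrow> L Q) at_infinity) \<and>
          (SUP Q\<in>beta_cubes \<beta>. L Q) = 0)}"

primrec continuously_differentiable ::
    "nat \<Rightarrow> ('a::real_normed_vector \<Rightarrow> 'b::real_normed_vector) \<Rightarrow> bool" where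
  "continuously_differentiable 0 f \<longleftrightarrow> continuous_on UNIV f"
| "continuously_differentiable (Suc k) f \<longleftrightarrow> (\<forall>x. f differentiable at x) \<and>
     (\<forall>v. continuously_differentiable k (\<lambda>x. frechet_derivative f (at x) v))"

definition test_function :: "(real ^ 'n \<Rightarrow> complex) \<Rightarrow> bool" where
  "test_function g \<longleftrightarrow> (\<forall>k. continuously_differentiable k g) \<and> compact (closure {x. g x \<noteq> 0})"

definition CMO :: "real ^ 'n \<Rightarrow> real \<Rightarrow> (real ^ 'n \<Rightarrow> complex) set" where
  "CMO \<beta> \<alpha> = {f \<in> BMO \<beta> \<alpha>. \<exists>g :: nat \<Rightarrow> real ^ 'n \<Rightarrow> complex.
     (\<forall>j. test_function (g j)) \<and> (\<lambda>j. bmo_norm \<beta> \<alpha> (\<lambda>x. f x - g j x)) \<longlonglongrightarrow> 0}"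

end

theory Submission
  imports Defs
begin

text \<open>A function of vanishing oscillation is approximated in two moves: first it is cut off at
  a large scale \<open>N\<close>, then the result is mollified at a small scale \<open>d\<close>. Both errors have to be
  small on boxes of all sizes and positions at once.

  The three vanishing conditions combine into one statement (\<open>VMO_compact\<close>): for every \<open>\<epsilon>\<close> there is
  a box \<open>B 0 M\<close> such that all boxes not contained in it have oscillation at most \<open>\<epsilon>\<close>. Let \<open>\<gamma>\<close> be the
  smallest entry of \<open>\<beta>\<close> and suppose first that \<open>\<alpha> \<le> \<gamma>\<close>. With \<open>c\<close> the average of \<open>f\<close> over \<open>B 0 N\<close>, put
  \<open>g = \<eta> (f - c)\<close> for a plateau function \<open>\<eta>\<close> that descends from 1 to 0 between the scales \<open>N\<close> and
  \<open>K N\<close> (\<open>cutoff\<close>). On a box of side \<open>l < N\<close> far from the origin, the product rule for oscillations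
  leaves the term (variation of \<open>\<eta>\<close>, at most \<open>(l / N) powr \<gamma>\<close>) times (difference between \<open>c\<close> and the
  average of \<open>f\<close> over the box). The second factor is estimated along the chain of boxes of side
  \<open>K ^ j * l\<close>, up to the scale \<open>N\<close>, all of which have small oscillation. In units of \<open>l powr \<alpha>\<close> it may
  grow like \<open>(N / l) powr \<alpha>\<close>, and for \<open>\<alpha> = 0\<close> like a logarithm, but for \<open>\<alpha> \<le> \<gamma>\<close> the variation of \<open>\<eta>\<close>
  absorbs this growth.

  Next, \<open>g\<close> is convolved with a smooth bump of scale \<open>d\<close>, where \<open>d\<close> is so small that \<open>g\<close> has small
  oscillation on all boxes of comparable side (\<open>mollify\<close>). The convolution \<open>h\<close> stays close to the
  averages of \<open>g\<close> over boxes of side about \<open>d\<close>, and its variation over a box of side \<open>l \<le> d\<close> is at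
  most a multiple of \<open>\<epsilon> * l powr \<alpha>\<close>, again by \<open>\<alpha> \<le> \<gamma>\<close>. The first property makes \<open>g - h\<close> small on boxes of
  side \<open>d\<close>, hence on larger ones, which are covered by a grid of such boxes
  (\<open>cover_integral\<close>). The second settles the boxes of side less than \<open>d\<close>.

  If \<open>\<alpha> > \<beta> $ i\<close> for some \<open>i\<close>, then \<open>f\<close> is essentially Hoelder continuous of order greater than one in
  direction \<open>i\<close> and is therefore invariant under translations in that direction. An oscillation that
  tends to 0 along these translations must be 0 from the start, so \<open>f\<close> is at distance 0
  from the zero function (\<open>VMO_osc_eq_0\<close>).\<close>

section \<open>Boxes adapted to anisotropic dilations\<close>

text \<open>These are the \<open>\<beta>\<close>-cubes, parametrised by centre and side (see \<open>beta_cubeE\<close>), because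
  translations and dilations act on these two parameters.\<close>

definition bbox :: "real ^ 'n \<Rightarrow> real ^ 'n \<Rightarrow> real \<Rightarrow> (real ^ 'n) set" where
  "bbox \<beta> x l = cbox (\<chi> i. x $ i - l powr \<beta> $ i / 2) (\<chi> i. x $ i + l powr \<beta> $ i / 2)"

lemma mem_bbox: "y \<in> bbox \<beta> x l \<longleftrightarrow> (\<forall>i. \<bar>y $ i - x $ i\<bar> \<le> l powr \<beta> $ i / 2)"
proof -
  have "x $ i - h \<le> y $ i \<and> y $ i \<le> x $ i + h \<longleftrightarrow> \<bar>y $ i - x $ i\<bar> \<le> h" for i h
    by linarith
  then show ?thesis
    by (simp add: bbox_def mem_box_cart)
qed

lemma compact_bbox [simp]: "compact (bbox \<beta> x l)"
  by (simp add: bbox_def)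

lemma lmeasurable_bbox [simp]: "bbox \<beta> x l \<in> lmeasurable"
  by (simp add: bbox_def)

lemma sets_bbox [measurable, simp]: "bbox \<beta> x l \<in> sets lebesgue"
  by (simp add: fmeasurableD)

text \<open>The number \<open>|\<beta>|\<close>, which plays the part of the dimension: volumes of boxes scale with this power
  of the side.\<close>

definition homdim :: "real ^ 'n \<Rightarrow> real" where
  "homdim \<beta> = (\<Sum>j\<in>UNIV. \<beta> $ j)"

lemma measure_bbox: "measure lebesgue (bbox \<beta> x l) = l powr homdim \<beta>" if "l > 0"
proof -
  have "measure lebesgue (bbox \<beta> x l) = (\<Prod>i\<in>UNIV. l powr \<beta> $ i)"
    unfolding bbox_def using that
    by (simp add: content_cbox_if_cart interval_eq_empty_cart not_le add_strict_mono less_le_trans)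
  then show ?thesis
    using that by (simp add: homdim_def powr_sum)
qed

lemma translate_bbox: "(\<lambda>y. y + t) ` bbox \<beta> x l = bbox \<beta> (x + t) l"
proof -
  have "y \<in> (\<lambda>y. y + t) ` bbox \<beta> x l" if "y \<in> bbox \<beta> (x + t) l" for y
    by (rule image_eqI[of _ _ "y - t"]) (use that in \<open>auto simp: mem_bbox algebra_simps\<close>)
  then show ?thesis
    by (auto simp: mem_bbox)
qed

definition minexp :: "real ^ 'n \<Rightarrow> real" where
  "minexp \<beta> = Min (range (($) \<beta>))"

text \<open>With this dilation factor every edge of a box grows at least threefold; an edge whose exponent is minimal
  grows exactly threefold. Threefold growth is what it takes to swallow every smaller box
  that touches a given one.\<close>

definition dil :: "real ^ 'n \<Rightarrow> real" where
  "dil \<beta> = 3 powr (1 / minexp \<beta>)"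

text \<open>Below, \<open>B x l\<close> is the box of centre \<open>x\<close> and side \<open>l\<close>, and \<open>p\<close> is the exponent for which an
  oscillation at most \<open>\<epsilon>\<close> means that the integral of \<open>|f - average|\<close> is at most \<open>\<epsilon> * l powr p\<close>
  (see \<open>osc_le_iff\<close>).\<close>

locale exponents =
  fixes \<beta> :: "real ^ 'n" and \<alpha> :: real
  assumes beta_pos: "\<And>i. \<beta> $ i > 0" and alpha0: "\<alpha> \<ge> 0"
begin

abbreviation (input) "B \<equiv> bbox \<beta>"
abbreviation (input) "K \<equiv> dil \<beta>"
abbreviation (input) "s \<equiv> homdim \<beta>"
abbreviation (input) "p \<equiv> \<alpha> + homdim \<beta>"
abbreviation (input) "\<gamma> \<equiv> minexp \<beta>"

lemma minexp_le: "minexp \<beta> \<le> \<beta> $ i"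
  unfolding minexp_def by simp

lemma minexp_pos: "minexp \<beta> > 0"
  unfolding minexp_def using beta_pos by (subst Min_gr_iff) auto

lemma minexp_attained: "\<exists>i. minexp \<beta> = \<beta> $ i"
proof -
  have "Min (range (($) \<beta>)) \<in> range (($) \<beta>)"
    by (rule Min_in) auto
  then show ?thesis
    unfolding minexp_def image_iff by blast
qed

lemma dil_gt1: "dil \<beta> > 1"
  unfolding dil_def using minexp_pos by simp

lemma dil_pos: "dil \<beta> > 0"
  using dil_gt1 by simp

lemma dil_powr: "dil \<beta> powr \<beta> $ i \<ge> 3"
proof -
  have "3 powr 1 \<le> 3 powr (\<beta> $ i / minexp \<beta>)"
    using minexp_le[of i] minexp_pos by (intro powr_mono) auto
  then show ?thesis
    by (simp add: dil_def powr_powr)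
qed

lemma homdim_pos: "homdim \<beta> > 0"
  unfolding homdim_def using beta_pos by (intro sum_pos) auto

lemma powr_le_dil:
  assumes "0 < l" "l \<le> m"
  shows "3 * l powr \<beta> $ i \<le> (dil \<beta> * m) powr \<beta> $ i"
proof -
  have "3 * l powr \<beta> $ i \<le> dil \<beta> powr \<beta> $ i * m powr \<beta> $ i"
    using assms beta_pos[of i] dil_powr[of i] by (intro mult_mono powr_mono2) (auto intro: less_imp_le)
  then show ?thesis
    using assms dil_pos by (simp add: powr_mult)
qed

text \<open>The engulfing property: a threefold edge leaves room for one more edge on either side.\<close>

lemma bbox_subset_dil:
  assumes "0 < l" "l \<le> m" and "z \<in> bbox \<beta> x l" "z \<in> bbox \<beta> y m"
  shows "bbox \<beta> x l \<subseteq> bbox \<beta> y (dil \<beta> * m)"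
proof
  fix w assume w: "w \<in> bbox \<beta> x l"
  show "w \<in> bbox \<beta> y (dil \<beta> * m)"
    unfolding mem_bbox
  proof
    fix i
    have "l powr \<beta> $ i \<le> m powr \<beta> $ i"
      using assms beta_pos[of i] by (intro powr_mono2) auto
    then have "\<bar>w $ i - y $ i\<bar> \<le> 3 * m powr \<beta> $ i / 2"
      using assms(3,4)[unfolded mem_bbox, rule_format, of i] w[unfolded mem_bbox, rule_format, of i]
      by linarith
    with powr_le_dil[of m m i] assms show "\<bar>w $ i - y $ i\<bar> \<le> (dil \<beta> * m) powr \<beta> $ i / 2"
      by linarith
  qed
qed

lemma bbox_mono:
  assumes "0 < l" "l \<le> m"
  shows "bbox \<beta> x l \<subseteq> bbox \<beta> x m"
proof
  fix w assume w: "w \<in> bbox \<beta> x l"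
  have "l powr \<beta> $ i \<le> m powr \<beta> $ i" for i
    using assms beta_pos[of i] by (intro powr_mono2) auto
  then have "l powr \<beta> $ i / 2 \<le> m powr \<beta> $ i / 2" for i
    by simp
  then show "w \<in> bbox \<beta> x m"
    using w unfolding mem_bbox by (meson order_trans)
qed

lemma
  assumes "l > 0"
  shows bbox_in_beta_cubes: "bbox \<beta> x l \<in> beta_cubes \<beta>"
    and side_bbox: "side \<beta> (bbox \<beta> x l) = l"
proof -
  let ?a = "\<chi> i. x $ i - l powr \<beta> $ i / 2" and ?b = "\<chi> i. x $ i + l powr \<beta> $ i / 2"
  have *: "(?b $ i - ?a $ i) powr (1 / \<beta> $ i) = l" for i
    using beta_pos[of i] assms by (simp add: powr_powr)
  have **: "?a $ i < ?b $ i" for i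
    using assms by simp
  show "bbox \<beta> x l \<in> beta_cubes \<beta>"
    unfolding beta_cubes_def bbox_def mem_Collect_eq
    by (intro exI[of _ ?a] exI[of _ ?b] conjI allI refl **) (simp only: *)
  show "side \<beta> (bbox \<beta> x l) = l"
    unfolding bbox_def using side_cbox[of ?a ?b \<beta>] * ** by metis
qed

lemma beta_cubeE:
  assumes "Q \<in> beta_cubes \<beta>"
  obtains x l where "l > 0" "Q = bbox \<beta> x l"
proof -
  obtain a b where Q: "Q = cbox a b" and ab: "\<And>i. a $ i < b $ i"
    and eq: "\<And>i j. (b $ i - a $ i) powr (1 / \<beta> $ i) = (b $ j - a $ j) powr (1 / \<beta> $ j)"
    using assms unfolding beta_cubes_def by blast
  \<comment> \<open>Any index may be used here, since all the normalised edge lengths agree.\<close>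
  define l where "l = (b $ undefined - a $ undefined) powr (1 / \<beta> $ undefined)"
  have l: "l powr \<beta> $ i = b $ i - a $ i" for i
  proof -
    have "l = (b $ i - a $ i) powr (1 / \<beta> $ i)"
      unfolding l_def by (rule eq)
    then show ?thesis
      using beta_pos[of i] ab[of i] by (simp add: powr_powr)
  qed
  have "l > 0"
    unfolding l_def using ab[of undefined] by simp
  moreover have "Q = bbox \<beta> (\<chi> i. (a $ i + b $ i) / 2) l"
    unfolding Q bbox_def l by (intro arg_cong2[where f = cbox]) (auto simp: vec_eq_iff field_simps)
  ultimately show ?thesis
    using that by blast
qed

end

section \<open>Mean deviations and oscillations\<close>

text \<open>The deviation from an arbitrary constant, without normalisation. A free constant allows
  comparisons with the average over another box, and the missing factor makes the
  deviation monotone in the box.\<close>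

definition dev :: "real ^ 'n \<Rightarrow> (real ^ 'n \<Rightarrow> complex) \<Rightarrow> complex \<Rightarrow> real ^ 'n \<Rightarrow> real \<Rightarrow> real" where
  "dev \<beta> f c x l = (LINT y:bbox \<beta> x l|lebesgue. cmod (f y - c))"

abbreviation "avg \<beta> f x l \<equiv> average f (bbox \<beta> x l)"

lemma locally_integrable_bbox: "set_integrable lebesgue (bbox \<beta> x l) f"
  if "locally_integrable f"
  using that unfolding locally_integrable_def by simp

lemma set_integrable_const_bbox: "set_integrable lebesgue (bbox \<beta> x l) (\<lambda>y. c)"
  for c :: "'a :: {banach, second_countable_topology}"
  unfolding set_integrable_def using lmeasurable_bbox[of \<beta> x l]
  by (auto simp: fmeasurable_def)

lemma locally_integrable_diff:
  "locally_integrable f \<Longrightarrow> locally_integrable g \<Longrightarrow> locally_integrable (\<lambda>x. f x - g x)"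
  unfolding locally_integrable_def by (auto intro: set_integral_diff)

lemma locally_integrable_integrable:
  fixes g :: "real ^ 'n \<Rightarrow> complex"
  assumes "integrable lebesgue g"
  shows "locally_integrable g"
  unfolding locally_integrable_def
proof (intro allI impI)
  fix C :: "(real ^ 'n) set" assume "compact C"
  then show "g absolutely_integrable_on C"
    unfolding set_integrable_def using assms
    by (intro integrable_mult_indicator) (auto intro: fmeasurableD lmeasurable_compact)
qed

lemma locally_integrable_continuous:
  fixes g :: "real ^ 'n \<Rightarrow> complex"
  assumes "continuous_on UNIV g"
  shows "locally_integrable g"
  unfolding locally_integrable_def
proof (intro allI impI)
  fix C :: "(real ^ 'n) set" assume "compact C"
  then have "integrable lborel (\<lambda>x. indicator C x *\<^sub>R g x)"
    by (intro borel_integrable_compact continuous_on_subset[OF assms]) auto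
  then show "g absolutely_integrable_on C"
    unfolding set_integrable_def using \<open>compact C\<close> borel_measurable_continuous_onI[OF assms]
    by (subst integrable_completion) (auto intro!: borel_measurable_scaleR borel_measurable_indicator borel_compact)
qed

lemma dev_integrable:
  "locally_integrable f \<Longrightarrow> set_integrable lebesgue (bbox \<beta> x l) (\<lambda>y. cmod (f y - c))"
  by (intro set_integrable_norm set_integral_diff locally_integrable_bbox set_integrable_const_bbox)

lemma osc_nonneg: "osc \<beta> \<alpha> f Q \<ge> 0"
  unfolding osc_def set_lebesgue_integral_def by (intro mult_nonneg_nonneg integral_nonneg_AE) auto

lemma LINT_const_bbox: "(LINT y:bbox \<beta> x l|lebesgue. c) = l powr homdim \<beta> *\<^sub>R (c :: 'a :: {banach, second_countable_topology})"
  if "l > 0"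
  using lmeasurable_bbox[of \<beta> x l]
  by (subst set_integral_const) (auto simp: measure_bbox that fmeasurable_def)

lemma LINT_mono_bbox:
  assumes "set_integrable lebesgue (bbox \<beta> y m) F" "bbox \<beta> x l \<subseteq> bbox \<beta> y m" "\<And>y. F y \<ge> (0::real)"
  shows "(LINT y:bbox \<beta> x l|lebesgue. F y) \<le> (LINT y:bbox \<beta> y m|lebesgue. F y)"
  unfolding set_lebesgue_integral_def
proof (rule integral_mono)
  show "integrable lebesgue (\<lambda>xa. indicat_real (bbox \<beta> x l) xa *\<^sub>R F xa)"
    using set_integrable_subset[OF assms(1) _ assms(2)] by (simp add: set_integrable_def)
  show "integrable lebesgue (\<lambda>xa. indicat_real (bbox \<beta> y m) xa *\<^sub>R F xa)"
    using assms(1) by (simp add: set_integrable_def)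
qed (use assms in \<open>auto simp: indicator_def\<close>)

lemma average_dev:
  assumes "locally_integrable f" "l > 0"
  shows "l powr homdim \<beta> * cmod (avg \<beta> f x l - c) \<le> dev \<beta> f c x l"
proof -
  have "l powr homdim \<beta> *\<^sub>R (avg \<beta> f x l - c) = (LINT y:bbox \<beta> x l|lebesgue. f y) - (LINT y:bbox \<beta> x l|lebesgue. c)"
    using assms by (simp add: average_def measure_bbox scaleR_diff_right LINT_const_bbox)
  also have "\<dots> = (LINT y:bbox \<beta> x l|lebesgue. f y - c)"
    by (rule set_integral_diff(2)[symmetric]) (auto intro: locally_integrable_bbox set_integrable_const_bbox assms)
  finally have "cmod (l powr homdim \<beta> *\<^sub>R (avg \<beta> f x l - c)) = cmod (LINT y:bbox \<beta> x l|lebesgue. f y - c)"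
    by simp
  also have "\<dots> \<le> dev \<beta> f c x l"
    unfolding dev_def by (rule set_integral_norm_bound)
      (intro set_integral_diff locally_integrable_bbox set_integrable_const_bbox assms)
  finally show ?thesis
    using assms by simp
qed

lemma dev_triangle:
  assumes "locally_integrable f" "l > 0"
  shows "dev \<beta> f c x l \<le> dev \<beta> f d x l + l powr homdim \<beta> * cmod (d - c)"
proof -
  have "dev \<beta> f c x l \<le> (LINT y:bbox \<beta> x l|lebesgue. cmod (f y - d) + cmod (d - c))"
    unfolding dev_def
    by (intro set_integral_mono dev_integrable set_integral_add set_integrable_const_bbox assms)
       (use norm_triangle_ineq[of "f _ - d" "d - c"] in simp)
  also have "\<dots> = dev \<beta> f d x l + l powr homdim \<beta> * cmod (d - c)"
    unfolding dev_def using assms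
    by (subst set_integral_add) (auto simp: dev_integrable set_integrable_const_bbox LINT_const_bbox)
  finally show ?thesis .
qed

text \<open>Up to a factor of two the average is the best constant, since its distance from any \<open>c\<close> is at
  most the mean deviation from \<open>c\<close>.\<close>

lemma dev_average_le:
  assumes "locally_integrable f" "l > 0"
  shows "dev \<beta> f (avg \<beta> f x l) x l \<le> 2 * dev \<beta> f c x l"
  using dev_triangle[OF assms, of \<beta> "avg \<beta> f x l" x c] average_dev[OF assms, of \<beta> x c]
  by (simp add: norm_minus_commute)

lemma dev_mono:
  assumes "locally_integrable f" "bbox \<beta> x l \<subseteq> bbox \<beta> y m"
  shows "dev \<beta> f c x l \<le> dev \<beta> f c y m"
  unfolding dev_def by (intro LINT_mono_bbox dev_integrable assms) auto

lemma average_diff_dev: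
  assumes "locally_integrable f" "l > 0" "bbox \<beta> x l \<subseteq> bbox \<beta> y m"
  shows "cmod (avg \<beta> f x l - c) \<le> dev \<beta> f c y m / l powr homdim \<beta>"
  using average_dev[OF assms(1,2), of \<beta> x c] dev_mono[OF assms(1,3), of c] assms(2)
  by (simp add: field_simps)

lemma osc_minus: "osc \<beta> \<alpha> (\<lambda>x. - f x) Q = osc \<beta> \<alpha> f Q"
proof -
  have "average (\<lambda>x. - f x) Q = - average f Q"
    by (simp add: average_def set_lebesgue_integral_def)
  then show ?thesis
    unfolding osc_def by (simp add: norm_minus_commute minus_diff_commute[symmetric])
qed

text \<open>One coordinate of the grid in \<open>cover_integral\<close>: the unit intervals with midpoints
  \<open>k + 1 / 2\<close> cover \<open>[0, s]\<close>. When \<open>s\<close> is an integer, its right end belongs to the last interval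
  as an end point, not as the beginning of a new one.\<close>

lemma exists_grid_interval:
  fixes t s :: real
  assumes "0 \<le> t" "t \<le> s" "s \<ge> 1"
  shows "\<exists>k < nat \<lceil>s\<rceil>. \<bar>t - (real k + 1 / 2)\<bar> \<le> 1 / 2"
proof -
  define k where "k = min (nat \<lfloor>t\<rfloor>) (nat \<lceil>s\<rceil> - 1)"
  have s: "nat \<lceil>s\<rceil> \<ge> 1"
    using assms(3) by linarith
  then have "k < nat \<lceil>s\<rceil>"
    unfolding k_def by linarith
  moreover have "\<bar>t - (real k + 1 / 2)\<bar> \<le> 1 / 2"
  proof (cases "nat \<lfloor>t\<rfloor> \<le> nat \<lceil>s\<rceil> - 1")
    case True
    then have "k = nat \<lfloor>t\<rfloor>"
      by (simp add: k_def)
    then have "real k = of_int \<lfloor>t\<rfloor>"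
      using assms(1) by simp
    then show ?thesis
      by linarith
  next
    case False
    then have "k = nat \<lceil>s\<rceil> - 1"
      by (simp add: k_def)
    moreover have "nat \<lfloor>t\<rfloor> = nat \<lceil>s\<rceil>"
      using False assms by linarith
    then have "\<lfloor>t\<rfloor> = \<lceil>s\<rceil>"
      using assms by linarith
    then have "t = of_int \<lceil>s\<rceil>"
      using assms by linarith
    moreover have "real (nat \<lceil>s\<rceil> - 1) = of_int \<lceil>s\<rceil> - 1"
      using s by (simp add: of_nat_diff)
    ultimately show ?thesis
      by simp
  qed
  ultimately show ?thesis
    by blast
qed

context exponents
begin

lemma osc_bbox: "osc \<beta> \<alpha> f (bbox \<beta> x l) = l powr - (\<alpha> + homdim \<beta>) * dev \<beta> f (avg \<beta> f x l) x l"
  if "l > 0"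
proof -
  have "(l powr homdim \<beta>) powr (- \<alpha> / homdim \<beta>) = l powr (- \<alpha>)"
    using homdim_pos by (simp add: powr_powr)
  then show ?thesis
    unfolding osc_def using that
    by (simp add: measure_bbox dev_def homdim_def[symmetric] powr_diff powr_minus divide_simps)
qed

lemma osc_le_iff: "osc \<beta> \<alpha> f (bbox \<beta> x l) \<le> E \<longleftrightarrow>
    dev \<beta> f (avg \<beta> f x l) x l \<le> E * l powr (\<alpha> + homdim \<beta>)"
  if "l > 0"
proof -
  have "l powr (\<alpha> + homdim \<beta>) > 0"
    using that by simp
  then show ?thesis
    unfolding osc_bbox[OF that] powr_minus by (simp add: field_simps)
qed

lemma osc_le_of_dev:
  assumes "locally_integrable f" "l > 0"
    and "dev \<beta> f c x l \<le> E * l powr (\<alpha> + homdim \<beta>)"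
  shows "osc \<beta> \<alpha> f (bbox \<beta> x l) \<le> 2 * E"
  using dev_average_le[OF assms(1,2), of \<beta> x c] assms by (simp add: osc_le_iff)

lemma osc_diff_le:
  assumes "locally_integrable f" "locally_integrable g" "l > 0"
  shows "osc \<beta> \<alpha> (\<lambda>x. f x - g x) (bbox \<beta> x l) \<le>
    osc \<beta> \<alpha> f (bbox \<beta> x l) + osc \<beta> \<alpha> g (bbox \<beta> x l)"
proof -
  have av: "avg \<beta> (\<lambda>x. f x - g x) x l = avg \<beta> f x l - avg \<beta> g x l"
    unfolding average_def
    by (subst set_integral_diff) (auto simp: scaleR_diff_right intro: locally_integrable_bbox assms)
  have "dev \<beta> (\<lambda>x. f x - g x) (avg \<beta> f x l - avg \<beta> g x l) x l
     \<le> (LINT y:bbox \<beta> x l|lebesgue. cmod (f y - avg \<beta> f x l) + cmod (g y - avg \<beta> g x l))"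
    unfolding dev_def
    by (intro set_integral_mono dev_integrable set_integral_add locally_integrable_diff assms)
       (use norm_triangle_ineq4[of "f _ - avg \<beta> f x l" "g _ - avg \<beta> g x l"] in \<open>simp add: algebra_simps\<close>)
  also have "\<dots> = dev \<beta> f (avg \<beta> f x l) x l + dev \<beta> g (avg \<beta> g x l) x l"
    unfolding dev_def using assms by (intro set_integral_add dev_integrable)
  finally show ?thesis
    using assms by (simp add: osc_bbox av distrib_left[symmetric] mult_left_mono)
qed

text \<open>Local estimates on boxes of a single side \<open>d\<close> control all larger boxes: fill the larger box with
  a grid of boxes of side \<open>d\<close>. Along each edge the grid overshoots by less than a factor of two, which
  gives the factor \<open>2 ^ CARD('n)\<close>. A grid is possible for arbitrary \<open>\<beta>\<close> because the numbers of boxes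
  along the different edges are chosen independently.\<close>

lemma cover_integral:
  fixes F :: "real ^ 'n \<Rightarrow> real"
  assumes d: "0 < d" "d \<le> l"
    and F0: "\<And>y. F y \<ge> 0" and F: "\<And>x l. set_integrable lebesgue (bbox \<beta> x l) F"
    and A: "\<And>z. (LINT y:bbox \<beta> z d|lebesgue. F y) \<le> A"
  shows "(LINT y:bbox \<beta> x l|lebesgue. F y) \<le> 2 ^ CARD('n) * (l / d) powr homdim \<beta> * A"
proof -
  define r where "r i = (l / d) powr \<beta> $ i" for i
  have r1: "r i \<ge> 1" for i
    unfolding r_def using beta_pos[of i] d by (intro ge_one_powr_ge_zero) auto
  have rd: "r i * d powr \<beta> $ i = l powr \<beta> $ i" for i
    unfolding r_def using d by (simp add: powr_divide)
  define I where "I = PiE UNIV (\<lambda>i. {..<nat \<lceil>r i\<rceil>})"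
  have finI: "finite I"
    unfolding I_def by (intro finite_PiE) auto
  define c where "c k = (\<chi> i. x $ i - l powr \<beta> $ i / 2 + (real (k i) + 1 / 2) * d powr \<beta> $ i)" for k
  have cov: "\<exists>k\<in>I. y \<in> bbox \<beta> (c k) d" if y: "y \<in> bbox \<beta> x l" for y
  proof -
    have "\<exists>k < nat \<lceil>r i\<rceil>. \<bar>(y $ i - x $ i + l powr \<beta> $ i / 2) / d powr \<beta> $ i - (real k + 1 / 2)\<bar> \<le> 1 / 2" for i
    proof (rule exists_grid_interval[OF _ _ r1])
      have y': "\<bar>y $ i - x $ i\<bar> \<le> l powr \<beta> $ i / 2"
        using y by (simp add: mem_bbox)
      have "0 \<le> y $ i - x $ i + l powr \<beta> $ i / 2"
        using y' by linarith
      then show "0 \<le> (y $ i - x $ i + l powr \<beta> $ i / 2) / d powr \<beta> $ i"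
        by simp
      have "y $ i - x $ i + l powr \<beta> $ i / 2 \<le> r i * d powr \<beta> $ i"
        unfolding rd using y' by linarith
      then show "(y $ i - x $ i + l powr \<beta> $ i / 2) / d powr \<beta> $ i \<le> r i"
        using d by (simp add: divide_le_eq)
    qed
    then obtain k where k: "\<And>i. k i < nat \<lceil>r i\<rceil>"
      "\<And>i. \<bar>(y $ i - x $ i + l powr \<beta> $ i / 2) / d powr \<beta> $ i - (real (k i) + 1 / 2)\<bar> \<le> 1 / 2"
      by metis
    have "k \<in> I"
      using k(1) by (auto simp: I_def)
    moreover have "\<bar>y $ i - c k $ i\<bar> \<le> d powr \<beta> $ i / 2" for i
    proof -
      have "y $ i - c k $ i = ((y $ i - x $ i + l powr \<beta> $ i / 2) / d powr \<beta> $ i - (real (k i) + 1 / 2)) * d powr \<beta> $ i"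
        using d by (simp add: c_def field_simps)
      also have "\<bar>\<dots>\<bar> \<le> 1 / 2 * d powr \<beta> $ i"
        unfolding abs_mult using k(2)[of i] by (intro mult_mono) auto
      finally show ?thesis
        by simp
    qed
    ultimately show ?thesis
      by (auto simp: mem_bbox)
  qed
  have int: "integrable lebesgue (\<lambda>y. indicat_real (bbox \<beta> x l) y *\<^sub>R F y)" for x l
    using F[of x l] by (simp add: set_integrable_def)
  have A0: "A \<ge> 0"
    by (rule order_trans[OF _ A[of 0]]) (simp add: set_lebesgue_integral_def F0)
  have "(LINT y:bbox \<beta> x l|lebesgue. F y) \<le> (LINT y|lebesgue. (\<Sum>k\<in>I. indicat_real (bbox \<beta> (c k) d) y *\<^sub>R F y))"
    unfolding set_lebesgue_integral_def
  proof (intro integral_mono int Bochner_Integration.integrable_sum)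
    fix y
    have nn: "0 \<le> indicat_real (bbox \<beta> (c k) d) y *\<^sub>R F y" for k
      using F0 by simp
    show "indicat_real (bbox \<beta> x l) y *\<^sub>R F y \<le> (\<Sum>k\<in>I. indicat_real (bbox \<beta> (c k) d) y *\<^sub>R F y)"
    proof (cases "y \<in> bbox \<beta> x l")
      case True
      then obtain k where k: "k \<in> I" "y \<in> bbox \<beta> (c k) d"
        using cov by blast
      then have "indicat_real (bbox \<beta> x l) y *\<^sub>R F y = indicat_real (bbox \<beta> (c k) d) y *\<^sub>R F y"
        using True by simp
      also have "\<dots> \<le> (\<Sum>k\<in>I. indicat_real (bbox \<beta> (c k) d) y *\<^sub>R F y)"
        using k(1) nn finI by (intro member_le_sum) auto
      finally show ?thesis .
    qed (use nn in \<open>auto intro!: sum_nonneg simp: F0\<close>)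
  qed
  also have "\<dots> = (\<Sum>k\<in>I. LINT y:bbox \<beta> (c k) d|lebesgue. F y)"
    unfolding set_lebesgue_integral_def by (rule Bochner_Integration.integral_sum[OF int])
  also have "\<dots> \<le> (\<Sum>k\<in>I. A)"
    by (intro sum_mono A)
  also have "\<dots> = (\<Prod>i\<in>UNIV. real (nat \<lceil>r i\<rceil>)) * A"
    unfolding I_def by (simp add: card_PiE)
  also have "\<dots> \<le> (\<Prod>i\<in>UNIV. 2 * r i) * A"
  proof (intro mult_right_mono prod_mono conjI A0)
    show "real (nat \<lceil>r i\<rceil>) \<le> 2 * r i" for i
      using r1[of i] by linarith
  qed auto
  also have "(\<Prod>i\<in>UNIV. 2 * r i) = 2 ^ CARD('n) * (l / d) powr homdim \<beta>"
    unfolding r_def homdim_def prod.distrib using d by (simp add: powr_sum)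
  finally show ?thesis .
qed

end

section \<open>Vanishing oscillation\<close>

context exponents
begin

lemma bmo_norm_le:
  assumes "\<And>x l. l > 0 \<Longrightarrow> osc \<beta> \<alpha> f (bbox \<beta> x l) \<le> E"
  shows "bmo_norm \<beta> \<alpha> f \<le> ennreal E"
  unfolding bmo_norm_def
proof (rule SUP_least)
  fix Q assume "Q \<in> beta_cubes \<beta>"
  then obtain x l where "l > 0" "Q = bbox \<beta> x l"
    using beta_cubeE by metis
  then show "ennreal (osc \<beta> \<alpha> f Q) \<le> ennreal E"
    using assms by (simp add: ennreal_leI)
qed

lemma BMO_bounded:
  assumes "f \<in> BMO \<beta> \<alpha>"
  shows "\<exists>A\<ge>0. \<forall>x l. l > 0 \<longrightarrow> osc \<beta> \<alpha> f (bbox \<beta> x l) \<le> A"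
proof -
  define A where "A = enn2real (bmo_norm \<beta> \<alpha> f)"
  have A: "bmo_norm \<beta> \<alpha> f = ennreal A"
    using assms by (auto simp: BMO_def A_def)
  have A0: "A \<ge> 0"
    by (simp add: A_def)
  have "osc \<beta> \<alpha> f (bbox \<beta> x l) \<le> A" if "l > 0" for x l
  proof -
    have "ennreal (osc \<beta> \<alpha> f (bbox \<beta> x l)) \<le> bmo_norm \<beta> \<alpha> f"
      unfolding bmo_norm_def by (intro SUP_upper bbox_in_beta_cubes that)
    then show ?thesis
      unfolding A using A0 by simp
  qed
  with A0 show ?thesis
    by blast
qed

lemma VMO_BMO: "f \<in> VMO \<beta> \<alpha> \<Longrightarrow> f \<in> BMO \<beta> \<alpha>"
  by (simp add: VMO_def)

lemma VMO_loc: "f \<in> VMO \<beta> \<alpha> \<Longrightarrow> locally_integrable f"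
  by (simp add: VMO_def BMO_def)

lemma VMO_small:
  assumes f: "f \<in> VMO \<beta> \<alpha>" and \<epsilon>: "\<epsilon> > 0"
  shows "\<exists>d>0. \<forall>x l. 0 < l \<longrightarrow> l \<le> d \<longrightarrow> osc \<beta> \<alpha> f (bbox \<beta> x l) \<le> \<epsilon>"
proof -
  have "((\<lambda>r. SUP Q\<in>{Q \<in> beta_cubes \<beta>. side \<beta> Q \<le> r}. ennreal (osc \<beta> \<alpha> f Q)) \<longlongrightarrow> 0) (at_right 0)"
    using f by (simp add: VMO_def)
  then have "\<forall>\<^sub>F r in at_right 0. (SUP Q\<in>{Q \<in> beta_cubes \<beta>. side \<beta> Q \<le> r}. ennreal (osc \<beta> \<alpha> f Q)) < ennreal \<epsilon>"
    by (rule order_tendstoD) (use assms in simp)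
  then obtain b where b: "b > 0"
    "\<And>r. r > 0 \<Longrightarrow> r < b \<Longrightarrow> (SUP Q\<in>{Q \<in> beta_cubes \<beta>. side \<beta> Q \<le> r}. ennreal (osc \<beta> \<alpha> f Q)) < ennreal \<epsilon>"
    unfolding eventually_at_right_field by auto
  show ?thesis
  proof (intro exI[of _ "b / 2"] conjI allI impI)
    fix x l assume l: "0 < l" "l \<le> b / 2"
    have "ennreal (osc \<beta> \<alpha> f (bbox \<beta> x l)) \<le> (SUP Q\<in>{Q \<in> beta_cubes \<beta>. side \<beta> Q \<le> b / 2}. ennreal (osc \<beta> \<alpha> f Q))"
      by (rule SUP_upper) (use l in \<open>simp add: bbox_in_beta_cubes side_bbox\<close>)
    also have "\<dots> \<le> ennreal \<epsilon>"
      using b by (intro less_imp_le b) auto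
    finally show "osc \<beta> \<alpha> f (bbox \<beta> x l) \<le> \<epsilon>"
      using assms by simp
  qed (use b in simp)
qed

lemma VMO_large:
  assumes f: "f \<in> VMO \<beta> \<alpha>" and \<epsilon>: "\<epsilon> > 0"
  shows "\<exists>R>0. \<forall>x l. R \<le> l \<longrightarrow> osc \<beta> \<alpha> f (bbox \<beta> x l) \<le> \<epsilon>"
proof -
  have "((\<lambda>r. SUP Q\<in>{Q \<in> beta_cubes \<beta>. side \<beta> Q \<ge> r}. ennreal (osc \<beta> \<alpha> f Q)) \<longlongrightarrow> 0) at_top"
    using f by (simp add: VMO_def)
  then have "\<forall>\<^sub>F r in at_top. (SUP Q\<in>{Q \<in> beta_cubes \<beta>. side \<beta> Q \<ge> r}. ennreal (osc \<beta> \<alpha> f Q)) < ennreal \<epsilon>"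
    by (rule order_tendstoD) (use assms in simp)
  then obtain b where b:
    "\<And>r. r \<ge> b \<Longrightarrow> (SUP Q\<in>{Q \<in> beta_cubes \<beta>. side \<beta> Q \<ge> r}. ennreal (osc \<beta> \<alpha> f Q)) < ennreal \<epsilon>"
    unfolding eventually_at_top_linorder by auto
  define R where "R = max b 1"
  show ?thesis
  proof (intro exI[of _ R] conjI allI impI)
    fix x l assume l: "R \<le> l"
    then have "l > 0"
      by (simp add: R_def)
    then have "ennreal (osc \<beta> \<alpha> f (bbox \<beta> x l)) \<le> (SUP Q\<in>{Q \<in> beta_cubes \<beta>. side \<beta> Q \<ge> R}. ennreal (osc \<beta> \<alpha> f Q))"
      by (intro SUP_upper) (use l in \<open>simp add: bbox_in_beta_cubes side_bbox\<close>)
    also have "\<dots> \<le> ennreal \<epsilon>"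
      using b[of R] by (simp add: R_def less_imp_le)
    finally show "osc \<beta> \<alpha> f (bbox \<beta> x l) \<le> \<epsilon>"
      using assms by simp
  qed (simp add: R_def)
qed

lemma VMO_far:
  assumes f: "f \<in> VMO \<beta> \<alpha>" and "\<epsilon> > 0" "l > 0"
  shows "\<exists>\<rho>>0. \<forall>t. \<rho> \<le> norm t \<longrightarrow> osc \<beta> \<alpha> f (bbox \<beta> (x + t) l) \<le> \<epsilon>"
proof -
  obtain L where L: "\<And>Q. Q \<in> beta_cubes \<beta> \<Longrightarrow>
      ((\<lambda>t. ennreal (osc \<beta> \<alpha> f ((\<lambda>y. y + t) ` Q))) \<longlongrightarrow> L Q) at_infinity"
    and sup: "(SUP Q\<in>beta_cubes \<beta>. L Q) = (0 :: ennreal)"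
    using f unfolding VMO_def by blast
  let ?Q = "bbox \<beta> x l"
  have Q: "?Q \<in> beta_cubes \<beta>"
    by (intro bbox_in_beta_cubes beta_pos assms)
  have "L ?Q \<le> (SUP Q\<in>beta_cubes \<beta>. L Q)"
    by (rule SUP_upper[OF Q])
  then have "L ?Q = 0"
    by (simp add: sup)
  with L[OF Q] have "((\<lambda>t. ennreal (osc \<beta> \<alpha> f (bbox \<beta> (x + t) l))) \<longlongrightarrow> 0) at_infinity"
    by (simp add: translate_bbox)
  then have "\<forall>\<^sub>F t in at_infinity. ennreal (osc \<beta> \<alpha> f (bbox \<beta> (x + t) l)) < ennreal \<epsilon>"
    by (rule order_tendstoD) (use assms in simp)
  then obtain b where b: "\<And>t. norm t \<ge> b \<Longrightarrow> ennreal (osc \<beta> \<alpha> f (bbox \<beta> (x + t) l)) < ennreal \<epsilon>"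
    unfolding eventually_at_infinity by blast
  have "osc \<beta> \<alpha> f (bbox \<beta> (x + t) l) \<le> \<epsilon>" if "max b 1 \<le> norm t" for t
    using b[of t] that by (simp add: ennreal_less_iff[OF osc_nonneg])
  then show ?thesis
    by (intro exI[of _ "max b 1"]) auto
qed

text \<open>Passing to a concentric box of comparable side costs at most a power of the ratio of the sides. This
  turns decay at infinity for the boxes of one side into decay that is uniform over a compact
  range of sides.\<close>

lemma osc_shrink:
  assumes "locally_integrable g" "0 < d" "d \<le> l" "l \<le> R"
  shows "osc \<beta> \<alpha> g (bbox \<beta> x l) \<le> 2 * (osc \<beta> \<alpha> g (bbox \<beta> x R) * (R / d) powr (\<alpha> + homdim \<beta>))"
proof (rule osc_le_of_dev[OF assms(1)])
  show "l > 0"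
    using assms by simp
  let ?p = "\<alpha> + homdim \<beta>" and ?o = "osc \<beta> \<alpha> g (bbox \<beta> x R)"
  have p: "?p > 0"
    using homdim_pos alpha0 by linarith
  have "dev \<beta> g (avg \<beta> g x R) x l \<le> dev \<beta> g (avg \<beta> g x R) x R"
    using assms by (intro dev_mono bbox_mono beta_pos) auto
  also have "\<dots> \<le> ?o * R powr ?p"
    using osc_le_iff[of R g x ?o] assms beta_pos by simp
  also have "\<dots> \<le> ?o * ((R / d) powr ?p * l powr ?p)"
  proof (rule mult_left_mono[OF _ osc_nonneg])
    have "R powr ?p \<le> (R / d * l) powr ?p"
      using assms p by (intro powr_mono2) (auto simp: field_simps mult_mono)
    then show "R powr ?p \<le> (R / d) powr ?p * l powr ?p"
      using assms by (subst powr_mult[symmetric]) auto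
  qed
  finally show "dev \<beta> g (avg \<beta> g x R) x l \<le> ?o * (R / d) powr ?p * l powr ?p"
    by (simp add: mult.assoc)
qed

text \<open>Boxes that are short or long are covered by the first two vanishing conditions, and boxes of
  intermediate side with a remote centre by the third one together with \<open>osc_shrink\<close>. The remaining
  boxes have bounded side and bounded centre, so that one box contains them all.\<close>

lemma VMO_compact:
  assumes f: "f \<in> VMO \<beta> \<alpha>" and \<epsilon>: "\<epsilon> > 0"
  shows "\<exists>M>0. \<forall>x l. l > 0 \<longrightarrow> \<not> bbox \<beta> x l \<subseteq> bbox \<beta> 0 M \<longrightarrow> osc \<beta> \<alpha> f (bbox \<beta> x l) \<le> \<epsilon>"
proof -
  obtain d where d: "d > 0" "\<And>x l. 0 < l \<Longrightarrow> l \<le> d \<Longrightarrow> osc \<beta> \<alpha> f (bbox \<beta> x l) \<le> \<epsilon>"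
    using VMO_small[OF f \<epsilon>] by blast
  obtain R where R: "R > 0" "\<And>x l. R \<le> l \<Longrightarrow> osc \<beta> \<alpha> f (bbox \<beta> x l) \<le> \<epsilon>"
    using VMO_large[OF f \<epsilon>] by blast
  let ?c = "2 * (R / d) powr (\<alpha> + homdim \<beta>)"
  have c: "?c > 0"
    using d R by simp
  then have "\<epsilon> / ?c > 0"
    using assms by simp
  from VMO_far[OF f this R(1), of 0] obtain \<rho> where
    \<rho>: "\<rho> > 0" "\<And>t. \<rho> \<le> norm t \<Longrightarrow> osc \<beta> \<alpha> f (bbox \<beta> t R) \<le> \<epsilon> / ?c"
    by auto
  have "\<forall>\<^sub>F M in at_top. \<forall>i. M powr \<beta> $ i \<ge> 2 * \<rho> + R powr \<beta> $ i"
    using real_powr_at_top[OF beta_pos] unfolding filterlim_at_top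
    by (intro eventually_all_finite) blast
  then obtain M where M: "M > 0" "\<And>i. M powr \<beta> $ i \<ge> 2 * \<rho> + R powr \<beta> $ i"
    using eventually_happens[OF eventually_conj[OF eventually_gt_at_top[of 0]]] by force
  have "osc \<beta> \<alpha> f (bbox \<beta> x l) \<le> \<epsilon>" if l: "l > 0" and sub: "\<not> bbox \<beta> x l \<subseteq> bbox \<beta> 0 M" for x l
  proof -
    consider "l \<le> d" | "R \<le> l" | "d < l" "l < R" "\<rho> \<le> norm x" | "l < R" "norm x < \<rho>"
      by linarith
    then show ?thesis
    proof cases
      case 3
      have "osc \<beta> \<alpha> f (bbox \<beta> x l) \<le> osc \<beta> \<alpha> f (bbox \<beta> x R) * ?c"
        using osc_shrink[OF VMO_loc[OF f] d(1), of l R x] 3 by simp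
      also have "\<dots> \<le> \<epsilon> / ?c * ?c"
        by (intro mult_right_mono \<rho> 3) simp
      finally show ?thesis
        using c by simp
    next
      case 4
      have "bbox \<beta> x l \<subseteq> bbox \<beta> 0 M"
      proof
        fix y assume y: "y \<in> bbox \<beta> x l"
        show "y \<in> bbox \<beta> 0 M"
          unfolding mem_bbox
        proof
          fix i
          have "\<bar>y $ i - x $ i\<bar> \<le> l powr \<beta> $ i / 2"
            using y by (simp add: mem_bbox)
          moreover have "l powr \<beta> $ i \<le> R powr \<beta> $ i"
            using 4 l beta_pos[of i] by (intro powr_mono2) auto
          moreover have "\<bar>x $ i\<bar> \<le> \<rho>"
            using component_le_norm_cart[of x i] 4 by linarith
          ultimately have "\<bar>y $ i\<bar> \<le> M powr \<beta> $ i / 2"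
            using M(2)[of i] by linarith
          then show "\<bar>y $ i - 0 $ i\<bar> \<le> M powr \<beta> $ i / 2"
            by simp
        qed
      qed
      with sub show ?thesis
        by blast
    qed (use d R l in auto)
  qed
  with M show ?thesis
    by blast
qed

end

section \<open>Cutting off at a large scale\<close>

locale low_exponents = exponents \<beta> \<alpha> for \<beta> :: "real ^ 'n" and \<alpha> +
  assumes alpha: "\<alpha> \<le> minexp \<beta>"
begin

lemma p_pos: "p > 0"
  using homdim_pos alpha0 by linarith

lemma subset_imp_le:
  assumes "0 < l" "0 < m" "B x l \<subseteq> B y m"
  shows "l \<le> m"
proof -
  have "measure lebesgue (B x l) \<le> measure lebesgue (B y m)"
    by (rule measure_mono_fmeasurable[OF assms(3)]) auto
  then have "l powr s \<le> m powr s"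
    using assms by (simp add: measure_bbox)
  then show ?thesis
    using assms homdim_pos by (metis less_eq_real_def not_less powr_less_mono2)
qed

lemma average_compare:
  assumes "locally_integrable f" "0 < l" "B x l \<subseteq> B y m"
    and "dev \<beta> f (avg \<beta> f y m) y m \<le> \<epsilon> * m powr p"
  shows "cmod (avg \<beta> f x l - avg \<beta> f y m) \<le> \<epsilon> * m powr p / l powr s"
  using order_trans[OF average_diff_dev[OF assms(1-3), of "avg \<beta> f y m"] divide_right_mono[OF assms(4), of "l powr s"]]
  by simp

text \<open>Telescoping over successive dilations with common centre. The growth of the sum on the right
  decides how strongly averages can drift between two scales.\<close>

lemma average_chain:
  assumes f: "locally_integrable f" and l: "0 < l"
    and dev: "\<And>j. 1 \<le> j \<Longrightarrow> j \<le> k \<Longrightarrow>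
      dev \<beta> f (avg \<beta> f x (K ^ j * l)) x (K ^ j * l) \<le> \<epsilon> * (K ^ j * l) powr p"
  shows "cmod (avg \<beta> f x l - avg \<beta> f x (K ^ k * l)) \<le> \<epsilon> * K powr s * (\<Sum>j=1..k. (K ^ j * l) powr \<alpha>)"
  using dev
proof (induction k)
  case (Suc k)
  let ?a = "K ^ k * l" and ?b = "K ^ Suc k * l"
  have K: "K > 0" "K \<ge> 1"
    using dil_gt1 by auto
  have a: "?a > 0"
    using K l by simp
  have b: "?b = K * ?a"
    by simp
  have "cmod (avg \<beta> f x ?a - avg \<beta> f x ?b) \<le> \<epsilon> * ?b powr p / ?a powr s"
  proof (rule average_compare[OF f a])
    show "B x ?a \<subseteq> B x ?b"
      unfolding b using a K mult_right_mono[OF K(2), of ?a] by (intro bbox_mono) auto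
    show "dev \<beta> f (avg \<beta> f x ?b) x ?b \<le> \<epsilon> * ?b powr p"
      by (rule Suc.prems) auto
  qed
  also have "\<dots> = \<epsilon> * K powr s * ?b powr \<alpha>"
    unfolding b using K a by (simp add: powr_add powr_mult del: mult_pos_pos)
  finally have "cmod (avg \<beta> f x l - avg \<beta> f x ?b) \<le>
      \<epsilon> * K powr s * (\<Sum>j=1..k. (K ^ j * l) powr \<alpha>) + \<epsilon> * K powr s * ?b powr \<alpha>"
    using Suc.IH[OF Suc.prems] norm_triangle_ineq[of "avg \<beta> f x l - avg \<beta> f x ?a" "avg \<beta> f x ?a - avg \<beta> f x ?b"]
    by simp
  then show ?case
    by (simp add: distrib_left)
qed simp

lemma dil_power_powr: "(K ^ j) powr \<gamma> = 3 ^ j"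
proof -
  have "(K ^ j) powr \<gamma> = (K powr \<gamma>) ^ j"
    using dil_gt1 by (simp add: powr_power powr_realpow[symmetric] powr_powr mult.commute)
  also have "K powr \<gamma> = 3"
    using minexp_pos by (simp add: dil_def powr_powr)
  finally show ?thesis .
qed

text \<open>The terms are bounded by powers of \<open>K powr \<gamma> = 3\<close>, and a geometric sum is comparable to its
  last term. This bound is uniform down to \<open>\<alpha> = 0\<close>, where the sum itself is only linear in \<open>k\<close>.\<close>

lemma sum_dil_powr_le:
  assumes "l > 0"
  shows "(\<Sum>j=1..k. (K ^ j * l) powr \<alpha>) \<le> 3 / 2 * 3 ^ k * l powr \<alpha>"
proof -
  have "(K ^ j) powr \<alpha> \<le> 3 ^ j" for j
  proof -
    have "K ^ j \<ge> 1"
      using dil_gt1 by simp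
    then have "(K ^ j) powr \<alpha> \<le> (K ^ j) powr \<gamma>"
      using alpha by (intro powr_mono) auto
    then show ?thesis
      by (simp add: dil_power_powr)
  qed
  then have "(\<Sum>j=1..k. (K ^ j * l) powr \<alpha>) \<le> (\<Sum>j=1..k. 3 ^ j * l powr \<alpha>)"
    using assms dil_gt1 by (intro sum_mono) (simp add: powr_mult mult_right_mono)
  also have "\<dots> = (\<Sum>j=1..k. 3 ^ j) * l powr \<alpha>"
    by (simp add: sum_distrib_right)
  also have "\<dots> \<le> 3 / 2 * 3 ^ k * l powr \<alpha>"
  proof (rule mult_right_mono)
    show "(\<Sum>j=1..k. 3 ^ j) \<le> 3 / 2 * (3 :: real) ^ k"
      by (induction k) auto
  qed simp
  finally show ?thesis .
qed

text \<open>In rescaled coordinates \<open>B 0 N\<close> is the ball of radius \<open>1 / 2\<close> for the maximum norm, so a function of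
  that norm alone can descend from 1 to 0 between \<open>B 0 N\<close> and \<open>B 0 (K * N)\<close>.\<close>

definition plateau :: "real \<Rightarrow> real ^ 'n \<Rightarrow> real" where
  "plateau N x = max 0 (min 1 (3 / 2 - infnorm (\<chi> i. x $ i / N powr \<beta> $ i)))"

lemma infnorm_le_cart: "(\<And>i. \<bar>z $ i\<bar> \<le> e) \<Longrightarrow> infnorm (z :: real ^ 'n) \<le> e"
  unfolding infnorm_cart by (rule cSup_least) auto

lemma plateau_01: "0 \<le> plateau N x" "plateau N x \<le> 1"
  by (auto simp: plateau_def)

lemma plateau_eq_1:
  assumes "N > 0" "x \<in> B 0 N"
  shows "plateau N x = 1"
proof -
  have "infnorm (\<chi> i. x $ i / N powr \<beta> $ i) \<le> 1 / 2"
    by (rule infnorm_le_cart) (use assms in \<open>auto simp: mem_bbox divide_simps\<close>)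
  then show ?thesis
    by (simp add: plateau_def)
qed

lemma plateau_eq_0:
  assumes N: "N > 0" and x: "x \<notin> B 0 (K * N)"
  shows "plateau N x = 0"
proof -
  obtain i where "\<bar>x $ i\<bar> > (K * N) powr \<beta> $ i / 2"
    using x by (auto simp: mem_bbox not_le)
  then have "3 / 2 * N powr \<beta> $ i \<le> \<bar>x $ i\<bar>"
    using powr_le_dil[OF N order_refl, of i] by simp
  then have "3 / 2 \<le> \<bar>(\<chi> i. x $ i / N powr \<beta> $ i) $ i\<bar>"
    using N by (simp add: le_divide_eq)
  also have "\<dots> \<le> infnorm (\<chi> i. x $ i / N powr \<beta> $ i)"
    by (rule component_le_infnorm_cart)
  finally show ?thesis
    by (simp add: plateau_def)
qed

lemma plateau_lipschitz:
  assumes N: "N > 0" and yz: "\<And>i. \<bar>y $ i - z $ i\<bar> \<le> e * N powr \<beta> $ i"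
  shows "\<bar>plateau N y - plateau N z\<bar> \<le> e"
proof -
  define S where "S x = (\<chi> i. x $ i / N powr \<beta> $ i)" for x :: "real ^ 'n"
  have "infnorm (S y - S z) \<le> e"
    by (rule infnorm_le_cart)
      (use yz N in \<open>auto simp: S_def diff_divide_distrib[symmetric] divide_le_eq\<close>)
  moreover have "\<bar>infnorm (S y) - infnorm (S z)\<bar> \<le> infnorm (S y - S z)"
    by (rule absdiff_infnorm)
  ultimately show ?thesis
    unfolding plateau_def S_def[symmetric] by linarith
qed

lemma continuous_plateau: "N > 0 \<Longrightarrow> continuous_on UNIV (plateau N)"
  unfolding plateau_def by (intro continuous_intros) auto

text \<open>An upper bound for the constants that arise in the three cases of \<open>cutoff\<close>. It depends on \<open>\<beta>\<close> and \<open>\<alpha>\<close> alone, so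
  that \<open>\<epsilon>\<close> can be chosen after it.\<close>

definition cutoff_const :: real where
  "cutoff_const = 4 + 2 * K powr p * (1 + K powr s) + 9 * K powr s + 4 * K powr p * K powr p"

lemma cutoff_const_pos: "cutoff_const > 0"
  unfolding cutoff_const_def by (intro add_pos_nonneg) auto

text \<open>The approximant is the plateau function times \<open>f - c\<close>. On boxes of side at least \<open>N\<close>
  the integral of \<open>|g|\<close> is at most that of \<open>|f - c|\<close> over \<open>B 0 (K * N)\<close>, which is controlled by the
  oscillation at that scale. Boxes inside the plateau see the constant \<open>c\<close> as the error. The remaining boxes have
  small oscillation of \<open>f\<close>, and only the variation of the plateau function has to be weighed against
  the drift of the averages.\<close>

lemma cutoff:
  fixes f :: "real ^ 'n \<Rightarrow> complex"
  assumes f: "locally_integrable f" and M: "M > 0" and \<epsilon>: "\<epsilon> \<ge> 0"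
    and small: "\<And>x l. l > 0 \<Longrightarrow> \<not> B x l \<subseteq> B 0 M \<Longrightarrow> osc \<beta> \<alpha> f (B x l) \<le> \<epsilon>"
  shows "\<exists>g N. N > 0 \<and> integrable lebesgue g \<and> (\<forall>x. x \<notin> B 0 N \<longrightarrow> g x = 0) \<and>
    (\<forall>x l. l > 0 \<longrightarrow> osc \<beta> \<alpha> (\<lambda>x. f x - g x) (B x l) \<le> cutoff_const * \<epsilon>)"
proof -
  have K: "K > 0" "K \<ge> 1"
    using dil_gt1 by auto
  define N where "N = K * M"
  have N: "N > 0" "N > M"
    using M dil_gt1 by (auto simp: N_def)
  have MN: "B 0 M \<subseteq> B 0 N"
    using M N by (intro bbox_mono) auto
  have small': "dev \<beta> f (avg \<beta> f x l) x l \<le> \<epsilon> * l powr p" if "l > 0" "\<not> B x l \<subseteq> B 0 M" for x l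
    using small[OF that] osc_le_iff[OF that(1)] by blast
  have big: "\<not> B x l \<subseteq> B 0 M" if "l \<ge> N" for x l
    using subset_imp_le[of l M x 0] that N M by auto
  define c where "c = avg \<beta> f 0 N"
  define g where "g x = plateau N x *\<^sub>R (f x - c)" for x
  have KN: "K * N > 0" "K * N \<ge> N" "K * (K * N) \<ge> N"
  proof -
    show "K * N > 0" using K N by simp
    show "K * N \<ge> N" using K N by simp
    then show "K * (K * N) \<ge> N"
      using mult_right_mono[OF K(2), of "K * N"] \<open>K * N > 0\<close> by linarith
  qed
  have g0: "g x = 0" if "x \<notin> B 0 (K * N)" for x
    using plateau_eq_0[OF N(1) that] by (simp add: g_def)
  have g_int: "integrable lebesgue g"
  proof (rule Bochner_Integration.integrable_bound)
    show int: "integrable lebesgue (\<lambda>x. indicat_real (B 0 (K * N)) x *\<^sub>R (f x - c))"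
      using set_integral_diff(1)[OF locally_integrable_bbox[OF f] set_integrable_const_bbox[of \<beta> 0 "K * N" c]]
      by (simp add: set_integrable_def)
    have [measurable]: "plateau N \<in> borel_measurable lebesgue"
      by (intro measurable_completion) (simp add: borel_measurable_continuous_onI continuous_plateau N)
    have "(\<lambda>x. plateau N x *\<^sub>R (indicat_real (B 0 (K * N)) x *\<^sub>R (f x - c))) \<in> borel_measurable lebesgue"
      by (intro borel_measurable_scaleR borel_measurable_integrable[OF int]) auto
    also have "(\<lambda>x. plateau N x *\<^sub>R (indicat_real (B 0 (K * N)) x *\<^sub>R (f x - c))) = g"
      using plateau_eq_0[OF N(1)] by (fastforce simp: g_def indicator_def fun_eq_iff)
    finally show "g \<in> borel_measurable lebesgue" .
    show "AE x in lebesgue. norm (g x) \<le> norm (indicat_real (B 0 (K * N)) x *\<^sub>R (f x - c))"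
    proof (rule AE_I2)
      fix x
      show "norm (g x) \<le> norm (indicat_real (B 0 (K * N)) x *\<^sub>R (f x - c))"
        using g0[of x] plateau_01[of N x] by (cases "x \<in> B 0 (K * N)") (auto simp: g_def intro!: mult_left_le_one_le)
    qed
  qed
  have g_loc: "locally_integrable g"
    by (rule locally_integrable_integrable[OF g_int])
  have fg_loc: "locally_integrable (\<lambda>x. f x - g x)"
    by (intro locally_integrable_diff f g_loc)
  have "osc \<beta> \<alpha> (\<lambda>x. f x - g x) (B x l) \<le> cutoff_const * \<epsilon>" if l: "l > 0" for x l
  proof -
    have bound: "E \<le> cutoff_const * \<epsilon>"
      if "E \<le> E' * \<epsilon>" "E' \<le> 4 + 2 * K powr p * (1 + K powr s) + 9 * K powr s + 4 * K powr p * K powr p" for E E'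
      using that[folded cutoff_const_def] \<epsilon> by (meson mult_right_mono order_trans)
    consider "l \<ge> N" | "B x l \<subseteq> B 0 N" | "l < N" "\<not> B x l \<subseteq> B 0 N"
      by linarith
    then show ?thesis
    proof cases
      \<comment> \<open>Here \<open>f\<close> and \<open>g\<close> are estimated separately; the support of \<open>g\<close> lies in \<open>B 0 (K * N)\<close>.\<close>
      case 1
      have "dev \<beta> g 0 x l \<le> dev \<beta> f c 0 (K * N)"
        unfolding dev_def set_lebesgue_integral_def
      proof (rule integral_mono)
        show "integrable lebesgue (\<lambda>y. indicat_real (B x l) y *\<^sub>R cmod (g y - 0))"
          using dev_integrable[OF g_loc, of \<beta> x l 0] by (simp add: set_integrable_def)
        show "integrable lebesgue (\<lambda>y. indicat_real (B 0 (K * N)) y *\<^sub>R cmod (f y - c))"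
          using dev_integrable[OF f, of \<beta> 0 "K * N" c] by (simp add: set_integrable_def)
        show "indicat_real (B x l) y *\<^sub>R cmod (g y - 0) \<le> indicat_real (B 0 (K * N)) y *\<^sub>R cmod (f y - c)" for y
          using g0[of y] plateau_01[of N y]
          by (cases "y \<in> B 0 (K * N)") (auto simp: g_def indicator_def intro!: mult_left_le_one_le)
      qed
      also have "\<dots> \<le> dev \<beta> f (avg \<beta> f 0 (K * N)) 0 (K * N) + (K * N) powr s * cmod (avg \<beta> f 0 (K * N) - c)"
        by (rule dev_triangle[OF f KN(1)])
      also have "\<dots> \<le> \<epsilon> * (K * N) powr p + (K * N) powr s * (\<epsilon> * (K * N) powr p / N powr s)"
      proof (intro add_mono mult_left_mono)
        show "dev \<beta> f (avg \<beta> f 0 (K * N)) 0 (K * N) \<le> \<epsilon> * (K * N) powr p"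
          by (intro small' KN big)
        then show "cmod (avg \<beta> f 0 (K * N) - c) \<le> \<epsilon> * (K * N) powr p / N powr s"
          unfolding c_def norm_minus_commute[of "avg \<beta> f 0 (K * N)"]
          by (intro average_compare[OF f N(1)] bbox_mono N KN)
      qed simp
      also have "\<dots> = \<epsilon> * K powr p * (1 + K powr s) * N powr p"
        using K N by (simp add: powr_mult field_simps)
      also have "\<dots> \<le> \<epsilon> * K powr p * (1 + K powr s) * l powr p"
        using 1 N \<epsilon> p_pos by (intro mult_left_mono powr_mono2) auto
      finally have "osc \<beta> \<alpha> g (B x l) \<le> 2 * (\<epsilon> * K powr p * (1 + K powr s))"
        by (intro osc_le_of_dev[OF g_loc l])
      moreover have "osc \<beta> \<alpha> f (B x l) \<le> \<epsilon>"
        using 1 by (intro small l big)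
      ultimately have "osc \<beta> \<alpha> (\<lambda>x. f x - g x) (B x l) \<le> (1 + 2 * K powr p * (1 + K powr s)) * \<epsilon>"
        using osc_diff_le[OF f g_loc l, of x] by (simp add: algebra_simps)
      then show ?thesis
        by (rule bound) simp
    next
      case 2
      have "dev \<beta> (\<lambda>x. f x - g x) c x l = (LINT y:B x l|lebesgue. 0)"
        unfolding dev_def using 2 by (intro set_lebesgue_integral_cong) (auto simp: g_def plateau_eq_1[OF N(1)])
      then have "dev \<beta> (\<lambda>x. f x - g x) c x l \<le> 0 * l powr p"
        by simp
      then have "osc \<beta> \<alpha> (\<lambda>x. f x - g x) (B x l) \<le> 2 * 0"
        by (rule osc_le_of_dev[OF fg_loc l])
      then have "osc \<beta> \<alpha> (\<lambda>x. f x - g x) (B x l) \<le> 0 * \<epsilon>"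
        by simp
      then show ?thesis
        by (rule bound) simp
    next
      case 3
      have notM: "\<not> B x l \<subseteq> B 0 M"
        using 3 MN by blast
      define C where "C = 9 / 2 * K powr s + 2 * K powr p * K powr p"
      have C0: "C \<ge> 0"
        by (simp add: C_def)
      have main: "\<bar>plateau N x - plateau N y\<bar> * cmod (avg \<beta> f x l - c) \<le> C * \<epsilon> * l powr \<alpha>" if y: "y \<in> B x l" for y
      proof (cases "B x l \<inter> B 0 (K * N) = {}")
        case True
        have "x \<in> B x l"
          by (simp add: mem_bbox)
        then have "plateau N x = 0" "plateau N y = 0"
          using True y by (auto intro!: plateau_eq_0[OF N(1)])
        then show ?thesis
          using C0 \<epsilon> by simp
      next
        case False
        then obtain z where z: "z \<in> B x l" "z \<in> B 0 (K * N)"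
          by blast
        \<comment> \<open>The number of dilations that lift the box to the scale \<open>N\<close>.\<close>
        define k where "k = (LEAST k. N \<le> K ^ k * l)"
        have ex: "\<exists>k. N \<le> K ^ k * l"
        proof -
          obtain k where "N / l < K ^ k"
            using real_arch_pow[OF dil_gt1] by blast
          then show ?thesis
            using l by (intro exI[of _ k]) (simp add: divide_less_eq)
        qed
        have k1: "N \<le> K ^ k * l"
          unfolding k_def using ex by (rule LeastI_ex)
        have "k \<noteq> 0"
          using k1 3 by (intro notI) simp
        then obtain k' where k': "k = Suc k'"
          by (cases k) auto
        have "K ^ k' * l < N"
          using not_less_Least[of k' "\<lambda>k. N \<le> K ^ k * l"] k' by (simp add: k_def[symmetric])
        then have k2: "K ^ k * l \<le> K * N"
          unfolding k' using K by simp
        let ?m = "K ^ k * l"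
        have lj: "l \<le> K ^ j * l" for j
          using l K by simp
        have jpos: "K ^ j * l > 0" for j
          using l K by simp
        have sub: "B x l \<subseteq> B x (K ^ j * l)" for j
          using l lj by (intro bbox_mono)
        have "cmod (avg \<beta> f x l - avg \<beta> f x ?m) \<le> \<epsilon> * K powr s * (\<Sum>j=1..k. (K ^ j * l) powr \<alpha>)"
        proof (rule average_chain[OF f l])
          fix j
          have "\<not> B x (K ^ j * l) \<subseteq> B 0 M"
            using sub[of j] notM by blast
          then show "dev \<beta> f (avg \<beta> f x (K ^ j * l)) x (K ^ j * l) \<le> \<epsilon> * (K ^ j * l) powr p"
            by (intro small' jpos)
        qed
        also have "\<dots> \<le> \<epsilon> * K powr s * (3 / 2 * 3 ^ k * l powr \<alpha>)"
          using \<epsilon> by (intro mult_left_mono sum_dil_powr_le l) auto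
        finally have avg1: "cmod (avg \<beta> f x l - avg \<beta> f x ?m) \<le> \<epsilon> * K powr s * (3 / 2 * 3 ^ k * l powr \<alpha>)" .
        \<comment> \<open>The lifted box and \<open>B 0 N\<close> are both contained in \<open>B 0 (K * (K * N))\<close>, which links their averages.\<close>
        let ?Q = "K * (K * N)"
        have Qpos: "?Q > 0"
          using K N by simp
        have devQ: "dev \<beta> f (avg \<beta> f 0 ?Q) 0 ?Q \<le> \<epsilon> * ?Q powr p"
          by (intro small' Qpos big KN)
        have avg2: "cmod (avg \<beta> f x ?m - avg \<beta> f 0 ?Q) \<le> \<epsilon> * ?Q powr p / N powr s"
        proof -
          have "cmod (avg \<beta> f x ?m - avg \<beta> f 0 ?Q) \<le> \<epsilon> * ?Q powr p / ?m powr s"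
          proof (rule average_compare[OF f jpos _ devQ])
            show "B x ?m \<subseteq> B 0 ?Q"
              using sub[of k] z by (intro bbox_subset_dil[OF jpos k2]) auto
          qed
          also have "\<dots> \<le> \<epsilon> * ?Q powr p / N powr s"
          proof (intro divide_left_mono)
            show "N powr s \<le> ?m powr s"
              using k1 N homdim_pos by (intro powr_mono2) auto
            then show "0 < ?m powr s * N powr s"
              using N jpos[of k] K by (intro mult_pos_pos) auto
          qed (use \<epsilon> in simp)
          finally show ?thesis .
        qed
        have avg3: "cmod (c - avg \<beta> f 0 ?Q) \<le> \<epsilon> * ?Q powr p / N powr s"
          unfolding c_def by (intro average_compare[OF f N(1) _ devQ] bbox_mono N KN)
        have W: "\<epsilon> * ?Q powr p / N powr s = \<epsilon> * (K powr p * K powr p * N powr \<alpha>)"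
          using K N by (simp add: powr_mult powr_add field_simps)
        have "cmod (avg \<beta> f x l - c) \<le> cmod (avg \<beta> f x l - avg \<beta> f x ?m) +
            cmod (avg \<beta> f x ?m - avg \<beta> f 0 ?Q) + cmod (c - avg \<beta> f 0 ?Q)"
          using norm_triangle_ineq[of "avg \<beta> f x l - avg \<beta> f x ?m" "avg \<beta> f x ?m - avg \<beta> f 0 ?Q"]
            norm_triangle_ineq4[of "avg \<beta> f x l - avg \<beta> f 0 ?Q" "c - avg \<beta> f 0 ?Q"]
          by simp
        also have "\<dots> \<le> \<epsilon> * K powr s * (3 / 2 * 3 ^ k * l powr \<alpha>) +
            \<epsilon> * (K powr p * K powr p * N powr \<alpha>) + \<epsilon> * (K powr p * K powr p * N powr \<alpha>)"
          by (intro add_mono avg1 avg2[unfolded W] avg3[unfolded W])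
        also have "\<dots> = \<epsilon> * (3 / 2 * K powr s * 3 ^ k * l powr \<alpha> + 2 * K powr p * K powr p * N powr \<alpha>)"
          by (simp add: distrib_left mult_ac)
        finally have "cmod (avg \<beta> f x l - c) \<le> \<epsilon> * (3 / 2 * K powr s * 3 ^ k * l powr \<alpha> + 2 * K powr p * K powr p * N powr \<alpha>)" .
        moreover have "\<bar>plateau N x - plateau N y\<bar> \<le> (l / N) powr \<gamma>"
        proof (rule plateau_lipschitz[OF N(1)])
          fix i
          have "\<bar>x $ i - y $ i\<bar> \<le> l powr \<beta> $ i"
            using y[unfolded mem_bbox, rule_format, of i] powr_ge_zero[of l "\<beta> $ i"] by linarith
          also have "\<dots> = (l / N) powr \<beta> $ i * N powr \<beta> $ i"
            using l N by (simp add: powr_divide)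
          also have "\<dots> \<le> (l / N) powr \<gamma> * N powr \<beta> $ i"
            using l N 3 by (intro mult_right_mono powr_mono' minexp_le) auto
          finally show "\<bar>x $ i - y $ i\<bar> \<le> (l / N) powr \<gamma> * N powr \<beta> $ i" .
        qed
        ultimately have "\<bar>plateau N x - plateau N y\<bar> * cmod (avg \<beta> f x l - c) \<le>
          (l / N) powr \<gamma> * (\<epsilon> * (3 / 2 * K powr s * 3 ^ k * l powr \<alpha> + 2 * K powr p * K powr p * N powr \<alpha>))"
          by (intro mult_mono) auto
        also have "\<dots> = \<epsilon> * (3 / 2 * K powr s * ((l / N) powr \<gamma> * 3 ^ k) * l powr \<alpha> + 2 * K powr p * K powr p * ((l / N) powr \<gamma> * N powr \<alpha>))"
          by (simp add: algebra_simps)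
        also have "\<dots> \<le> \<epsilon> * (3 / 2 * K powr s * 3 * l powr \<alpha> + 2 * K powr p * K powr p * l powr \<alpha>)"
        proof (intro mult_left_mono mult_right_mono add_mono \<epsilon>)
          have "(l / N) powr \<gamma> * 3 ^ k = (K ^ k * l / N) powr \<gamma>"
            using K l N by (simp add: powr_mult powr_divide dil_power_powr[symmetric])
          also have "\<dots> \<le> K powr \<gamma>"
            using k2 jpos[of k] N minexp_pos by (intro powr_mono2) (auto simp: divide_le_eq)
          also have "\<dots> = 3"
            using minexp_pos by (simp add: dil_def powr_powr)
          finally show "(l / N) powr \<gamma> * 3 ^ k \<le> 3" .
          have "(l / N) powr \<gamma> * N powr \<alpha> \<le> (l / N) powr \<alpha> * N powr \<alpha>"
            using l N 3 alpha by (intro mult_right_mono powr_mono') auto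
          also have "\<dots> = l powr \<alpha>"
            using l N by (simp add: powr_divide)
          finally show "(l / N) powr \<gamma> * N powr \<alpha> \<le> l powr \<alpha>" .
        qed auto
        also have "\<dots> = C * \<epsilon> * l powr \<alpha>"
          by (simp add: C_def algebra_simps)
        finally show ?thesis .
      qed
      \<comment> \<open>The error \<open>c + (1 - \<eta>) (f - c)\<close> with \<open>\<eta>\<close> frozen at the centre and \<open>f\<close> replaced by its average.\<close>
      define d where "d = c + (1 - plateau N x) *\<^sub>R (avg \<beta> f x l - c)"
      have "dev \<beta> (\<lambda>x. f x - g x) d x l \<le> (LINT y:B x l|lebesgue. cmod (f y - avg \<beta> f x l) + C * \<epsilon> * l powr \<alpha>)"
        unfolding dev_def set_lebesgue_integral_def
      proof (rule integral_mono)
        show "integrable lebesgue (\<lambda>y. indicat_real (B x l) y *\<^sub>R cmod (f y - g y - d))"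
          using dev_integrable[OF fg_loc, of \<beta> x l d] by (simp add: set_integrable_def)
        show "integrable lebesgue (\<lambda>y. indicat_real (B x l) y *\<^sub>R (cmod (f y - avg \<beta> f x l) + C * \<epsilon> * l powr \<alpha>))"
          using set_integral_add(1)[OF dev_integrable[OF f] set_integrable_const_bbox] by (simp add: set_integrable_def)
        fix y
        show "indicat_real (B x l) y *\<^sub>R cmod (f y - g y - d) \<le>
          indicat_real (B x l) y *\<^sub>R (cmod (f y - avg \<beta> f x l) + C * \<epsilon> * l powr \<alpha>)"
        proof (cases "y \<in> B x l")
          case True
          have "f y - g y - d = (1 - plateau N y) *\<^sub>R (f y - avg \<beta> f x l) + (plateau N x - plateau N y) *\<^sub>R (avg \<beta> f x l - c)"
            by (simp add: g_def d_def algebra_simps)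
          also have "cmod \<dots> \<le> cmod (f y - avg \<beta> f x l) + C * \<epsilon> * l powr \<alpha>"
          proof (rule norm_triangle_le, rule add_mono)
            show "cmod ((1 - plateau N y) *\<^sub>R (f y - avg \<beta> f x l)) \<le> cmod (f y - avg \<beta> f x l)"
              using plateau_01[of N y] by (auto intro!: mult_left_le_one_le)
          qed (use main[OF True] in simp)
          finally show ?thesis
            using True by simp
        qed simp
      qed
      also have "\<dots> = dev \<beta> f (avg \<beta> f x l) x l + l powr s * (C * \<epsilon> * l powr \<alpha>)"
        unfolding dev_def using LINT_const_bbox[OF l, of \<beta> x "C * \<epsilon> * l powr \<alpha>"]
        by (subst set_integral_add) (auto simp: dev_integrable[OF f] set_integrable_const_bbox)
      also have "\<dots> \<le> (1 + C) * \<epsilon> * l powr p"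
        using small'[OF l notM] by (simp add: powr_add algebra_simps)
      finally have "osc \<beta> \<alpha> (\<lambda>x. f x - g x) (B x l) \<le> 2 * ((1 + C) * \<epsilon>)"
        by (intro osc_le_of_dev[OF fg_loc l])
      then have "osc \<beta> \<alpha> (\<lambda>x. f x - g x) (B x l) \<le> (2 * (1 + C)) * \<epsilon>"
        by (simp only: mult.assoc)
      then show ?thesis
        by (rule bound) (simp add: C_def algebra_simps)
    qed
  qed
  then show ?thesis
    using g_int g0 KN(1) by blast
qed

end

section \<open>Smooth compactly supported kernels\<close>

text \<open>For \<open>m = 0\<close> this is the standard flat function. The powers of \<open>t\<close> in the denominator close the family
  under differentiation, up to linear combinations.\<close>

definition bumpfun :: "nat \<Rightarrow> real \<Rightarrow> real" where
  "bumpfun m t = (if t > 0 then exp (- 1 / t) / t ^ m else 0)"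

text \<open>A quadratic bound near 0, from a single term of the exponential series. It yields the derivative
  at 0 for all members of the family at once.\<close>

lemma bumpfun_le:
  assumes "t > 0"
  shows "bumpfun m t \<le> fact (m + 2) * t ^ 2"
proof -
  have "(1 / t) ^ (m + 2) / fact (m + 2) \<le> exp (1 / t)"
  proof -
    have "(\<Sum>n\<in>{m + 2}. (1 / t) ^ n /\<^sub>R fact n) \<le> (\<Sum>n. (1 / t) ^ n /\<^sub>R fact n)"
      by (rule sum_le_suminf) (use assms summable_exp_generic[of "1 / t"] in auto)
    then show ?thesis
      by (simp add: exp_def divide_inverse mult.commute)
  qed
  moreover define c :: real where "c = fact (m + 2)"
  moreover have "c > 0"
    unfolding c_def by simp
  ultimately have *: "1 / t ^ (m + 2) \<le> exp (1 / t) * c"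
    by (metis pos_divide_le_eq power_one_over)
  have "exp (- 1 / t) = exp (- 1 / t) * (1 / t ^ (m + 2)) * t ^ (m + 2)"
    using assms by simp
  also have "\<dots> \<le> exp (- 1 / t) * (exp (1 / t) * c) * t ^ (m + 2)"
    using assms * by (intro mult_right_mono mult_left_mono) auto
  also have "\<dots> = c * t ^ 2 * t ^ m"
    by (simp add: exp_minus power_add field_simps power2_eq_square)
  finally show ?thesis
    using assms by (simp add: bumpfun_def c_def divide_le_eq del: fact_Suc add_2_eq_Suc')
qed

lemma bumpfun_nonneg: "bumpfun m t \<ge> 0"
  by (simp add: bumpfun_def)

lemma has_derivative_bumpfun:
  "(bumpfun m has_real_derivative bumpfun (m + 2) t - real m * bumpfun (m + 1) t) (at t)"
proof -
  consider "t > 0" | "t < 0" | "t = 0"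
    by linarith
  then show ?thesis
  proof cases
    case 1
    have pw: "n = 0" if "t ^ n \<noteq> t * t ^ (n - Suc 0)" for n
      using that by (cases n) auto
    have "((\<lambda>t. exp (- 1 / t) / t ^ m) has_real_derivative bumpfun (m + 2) t - real m * bumpfun (m + 1) t) (at t)"
      using 1 by (cases m) (auto intro!: derivative_eq_intros dest: pw simp: bumpfun_def field_simps power2_eq_square)
    then show ?thesis
      by (rule has_field_derivative_transform_within_open[of _ _ _ "{0<..}"]) (use 1 in \<open>auto simp: bumpfun_def\<close>)
  next
    case 2
    have "((\<lambda>t. 0) has_real_derivative bumpfun (m + 2) t - real m * bumpfun (m + 1) t) (at t)"
      using 2 by (simp add: bumpfun_def)
    then show ?thesis
      by (rule has_field_derivative_transform_within_open[of _ _ _ "{..<0}"]) (use 2 in \<open>auto simp: bumpfun_def\<close>)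
  next
    case 3
    have "(\<lambda>h. (bumpfun m (0 + h) - bumpfun m 0) / h) \<midarrow>0\<rightarrow> 0"
    proof (rule Lim_null_comparison)
      show "\<forall>\<^sub>F h in at 0. norm ((bumpfun m (0 + h) - bumpfun m 0) / h) \<le> fact (m + 2) * \<bar>h\<bar>"
      proof (rule always_eventually, rule allI)
        fix h :: real
        show "norm ((bumpfun m (0 + h) - bumpfun m 0) / h) \<le> fact (m + 2) * \<bar>h\<bar>"
        proof (cases "h > 0")
          case True
          then have "bumpfun m h / h \<le> fact (m + 2) * h"
            using bumpfun_le[of h m] by (simp add: divide_le_eq power2_eq_square mult.assoc)
          with True bumpfun_nonneg[of m h] show ?thesis
            by (simp add: bumpfun_def[of m 0])
        next
          case False
          have "(0::real) \<le> fact (m + 2) * \<bar>h\<bar>"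
            by (intro mult_nonneg_nonneg) (rule fact_ge_zero, simp)
          then show ?thesis
            using False by (simp add: bumpfun_def del: fact_Suc add_2_eq_Suc')
        qed
      qed
      show "((\<lambda>h. fact (m + 2) * \<bar>h\<bar>) \<longlongrightarrow> 0) (at (0::real))"
        by (auto intro!: tendsto_eq_intros)
    qed
    then show ?thesis
      using 3 by (simp add: DERIV_def bumpfun_def)
  qed
qed

text \<open>A class of functions supported in \<open>norm (S x) \<le> 1\<close> that is closed under all directional derivatives.
  Membership therefore implies derivatives of every order, without a formula for any of them. The map
  \<open>S\<close> will be an anisotropic rescaling.\<close>

inductive bumps :: "('a::euclidean_space \<Rightarrow> 'a) \<Rightarrow> ('a \<Rightarrow> real) \<Rightarrow> bool" for S where
  base: "bumps S (\<lambda>x. bumpfun m (1 - S x \<bullet> S x))"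
| mult: "bumps S \<Phi> \<Longrightarrow> bumps S (\<lambda>x. (S x \<bullet> v) * \<Phi> x)"
| scale: "bumps S \<Phi> \<Longrightarrow> bumps S (\<lambda>x. c * \<Phi> x)"
| add: "bumps S \<Phi> \<Longrightarrow> bumps S \<Phi>' \<Longrightarrow> bumps S (\<lambda>x. \<Phi> x + \<Phi>' x)"

lemma bumps_support: "bumps S \<Phi> \<Longrightarrow> norm (S x) \<ge> 1 \<Longrightarrow> \<Phi> x = 0"
proof (induction rule: bumps.induct)
  case (base m)
  then have "S x \<bullet> S x \<ge> 1"
    by (simp add: norm_eq_sqrt_inner)
  then show ?case
    by (simp add: bumpfun_def)
qed auto

lemma bumps_deriv:
  assumes "bounded_linear S" "bumps S \<Phi>"
  shows "\<exists>D. (\<forall>x. (\<Phi> has_derivative D x) (at x)) \<and> (\<forall>v. bumps S (\<lambda>x. D x v))"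
  using assms(2)
proof (induction rule: bumps.induct)
  case (base m)
  have [derivative_intros]: "((\<lambda>x. S x) has_derivative S) (at x)" for x
    using assms(1) by (rule bounded_linear_imp_has_derivative)
  let ?g = "\<lambda>t. bumpfun (m + 2) t - real m * bumpfun (m + 1) t"
  let ?D = "\<lambda>x v. (- 2) * ((S x \<bullet> S v) * (bumpfun (m + 2) (1 - S x \<bullet> S x) + (- real m) * bumpfun (m + 1) (1 - S x \<bullet> S x)))"
  have "((\<lambda>x. bumpfun m (1 - S x \<bullet> S x)) has_derivative ?D x) (at x)" for x
  proof -
    have "((\<lambda>x. 1 - S x \<bullet> S x) has_derivative (\<lambda>v. - (2 * (S x \<bullet> S v)))) (at x)"
      by (auto intro!: derivative_eq_intros simp: inner_commute)
    from has_derivative_compose[OF this has_derivative_bumpfun[unfolded has_field_derivative_def, of m "1 - S x \<bullet> S x"]]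
    show ?thesis
      by (rule has_derivative_eq_rhs) (auto simp: algebra_simps)
  qed
  moreover have "bumps S (\<lambda>x. ?D x v)" for v
    by (intro bumps.intros)
  ultimately show ?case
    by (intro exI[of _ ?D] conjI allI)
next
  case (mult \<Phi> w)
  have [derivative_intros]: "((\<lambda>x. S x) has_derivative S) (at x)" for x
    using assms(1) by (rule bounded_linear_imp_has_derivative)
  from mult obtain D where D [derivative_intros]: "\<And>x. (\<Phi> has_derivative D x) (at x)" and b: "\<And>v. bumps S (\<lambda>x. D x v)"
    by blast
  have "((\<lambda>x. (S x \<bullet> w) * \<Phi> x) has_derivative (\<lambda>v. (S x \<bullet> w) * D x v + (S v \<bullet> w) * \<Phi> x)) (at x)" for x
    by (auto intro!: derivative_eq_intros)
  moreover have "bumps S (\<lambda>x. (S x \<bullet> w) * D x v + (S v \<bullet> w) * \<Phi> x)" for v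
    by (intro bumps.intros b mult)
  ultimately show ?case
    by (intro exI[of _ "\<lambda>x v. (S x \<bullet> w) * D x v + (S v \<bullet> w) * \<Phi> x"]) blast
next
  case (scale \<Phi> c)
  then obtain D where D: "\<And>x. (\<Phi> has_derivative D x) (at x)" and b: "\<And>v. bumps S (\<lambda>x. D x v)"
    by blast
  then show ?case
    by (intro exI[of _ "\<lambda>x v. c * D x v"]) (auto intro!: bumps.intros has_derivative_mult_right)
next
  case (add \<Phi> \<Phi>')
  then obtain D D' where "\<And>x. (\<Phi> has_derivative D x) (at x)" "\<And>v. bumps S (\<lambda>x. D x v)"
    "\<And>x. (\<Phi>' has_derivative D' x) (at x)" "\<And>v. bumps S (\<lambda>x. D' x v)"
    by metis
  then show ?case
    by (intro exI[of _ "\<lambda>x v. D x v + D' x v"]) (auto intro!: bumps.intros has_derivative_add)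
qed

definition conv :: "('a::euclidean_space \<Rightarrow> real) \<Rightarrow> ('a \<Rightarrow> complex) \<Rightarrow> 'a \<Rightarrow> complex" where
  "conv \<Phi> g x = (LINT y|lebesgue. \<Phi> (x - y) *\<^sub>R g y)"

context
  fixes S :: "'a::euclidean_space \<Rightarrow> 'a" and R :: real
  assumes S: "bounded_linear S" and R: "\<And>x. norm x \<ge> R \<Longrightarrow> norm (S x) \<ge> 1"
begin

lemma bumps_continuous: "bumps S \<Phi> \<Longrightarrow> continuous_on UNIV \<Phi>"
  using bumps_deriv[OF S] by (meson has_derivative_continuous_on has_derivative_at_withinI)

lemma bumps_bounded:
  assumes "bumps S \<Phi>"
  shows "\<exists>B. \<forall>x. \<bar>\<Phi> x\<bar> \<le> B"
proof -
  have "compact (\<Phi> ` cball 0 R)"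
    by (intro compact_continuous_image continuous_on_subset[OF bumps_continuous[OF assms]]) auto
  then obtain B where B: "\<And>y. y \<in> \<Phi> ` cball 0 R \<Longrightarrow> norm y \<le> B"
    using compact_imp_bounded bounded_iff by metis
  have "\<bar>\<Phi> x\<bar> \<le> max B 0" for x
  proof (cases "norm x \<le> R")
    case True
    then show ?thesis
      using B[of "\<Phi> x"] by (auto simp: le_max_iff_disj)
  next
    case False
    then show ?thesis
      using bumps_support[OF assms, of x] R[of x] by auto
  qed
  then show ?thesis
    by blast
qed

lemma bumps_lipschitz:
  assumes "bumps S \<Phi>"
  shows "\<exists>L\<ge>0. \<forall>x y. \<bar>\<Phi> x - \<Phi> y\<bar> \<le> L * norm (x - y)"
proof -
  obtain D where D: "\<And>x. (\<Phi> has_derivative D x) (at x)" and b: "\<And>v. bumps S (\<lambda>x. D x v)"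
    using bumps_deriv[OF S assms] by blast
  obtain B where B: "\<And>v x. \<bar>D x v\<bar> \<le> B v"
    using bumps_bounded[OF b] by metis
  define L where "L = (\<Sum>j\<in>Basis. B j)"
  have B0: "B v \<ge> 0" for v
    using B[of 0 v] by linarith
  have "onorm (D x) \<le> L" for x
  proof (rule onorm_le)
    fix v :: 'a
    have lin: "linear (D x)"
      using D has_derivative_linear by blast
    have "D x v = D x (\<Sum>j\<in>Basis. (v \<bullet> j) *\<^sub>R j)"
      by (simp add: euclidean_representation)
    also have "\<dots> = (\<Sum>j\<in>Basis. (v \<bullet> j) * D x j)"
      by (simp add: linear_sum[OF lin] linear_scale[OF lin])
    finally have "\<bar>D x v\<bar> \<le> (\<Sum>j\<in>Basis. \<bar>(v \<bullet> j) * D x j\<bar>)"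
      by (simp only: sum_abs)
    also have "\<dots> \<le> (\<Sum>j\<in>Basis. norm v * B j)"
      unfolding abs_mult by (intro sum_mono mult_mono Basis_le_norm B) auto
    finally show "norm (D x v) \<le> L * norm v"
      by (simp add: L_def sum_distrib_right sum_distrib_left mult_ac)
  qed
  then have "norm (\<Phi> x - \<Phi> y) \<le> L * norm (x - y)" for x y
    by (intro differentiable_bound[where S = UNIV and f' = D]) (auto intro: D)
  moreover have "L \<ge> 0"
    unfolding L_def by (intro sum_nonneg B0)
  ultimately show ?thesis
    by auto
qed

text \<open>The derivative again belongs to the class and so is Lipschitz; this gives a quadratic remainder that
  is uniform in the base point, as needed for differentiation under the integral sign.\<close>

lemma bumps_remainder:
  assumes D: "\<And>x. (\<Phi> has_derivative D x) (at x)" and b: "\<And>v. bumps S (\<lambda>x. D x v)"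
  shows "\<exists>C\<ge>0. \<forall>x y. \<bar>\<Phi> y - \<Phi> x - D x (y - x)\<bar> \<le> C * norm (y - x) ^ 2"
proof -
  obtain B where B0: "\<And>v. B v \<ge> 0" and B: "\<And>v x y. \<bar>D x v - D y v\<bar> \<le> B v * norm (x - y)"
    using bumps_lipschitz[OF b] by metis
  define L where "L = (\<Sum>j\<in>Basis. B j)"
  have L0: "L \<ge> 0"
    unfolding L_def by (intro sum_nonneg B0)
  have lin: "linear (D x)" for x
    using D has_derivative_linear by blast
  have on: "norm (D x v - D y v) \<le> L * norm (x - y) * norm v" for x y v
  proof -
    have D_eq: "D x v = (\<Sum>j\<in>Basis. (v \<bullet> j) * D x j)" for x v
    proof -
      have "D x v = D x (\<Sum>j\<in>Basis. (v \<bullet> j) *\<^sub>R j)"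
        by (simp add: euclidean_representation)
      also have "\<dots> = (\<Sum>j\<in>Basis. (v \<bullet> j) * D x j)"
        by (simp add: linear_sum[OF lin] linear_scale[OF lin])
      finally show ?thesis .
    qed
    have "\<bar>D x v - D y v\<bar> \<le> (\<Sum>j\<in>Basis. \<bar>(v \<bullet> j) * (D x j - D y j)\<bar>)"
      unfolding D_eq[of x v] D_eq[of y v] sum_subtractf[symmetric] right_diff_distrib[symmetric]
      by (rule sum_abs)
    also have "\<dots> \<le> (\<Sum>j\<in>Basis. norm v * (B j * norm (x - y)))"
      unfolding abs_mult by (intro sum_mono mult_mono Basis_le_norm B) auto
    finally show ?thesis
      by (simp add: L_def sum_distrib_right sum_distrib_left mult_ac)
  qed
  have "norm ((\<Phi> y - D x y) - (\<Phi> x - D x x)) \<le> (L * norm (y - x)) * norm (y - x)" for x y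
  proof (rule differentiable_bound[where S = "cball x (norm (y - x))" and f' = "\<lambda>z v. D z v - D x v"])
    fix z assume z: "z \<in> cball x (norm (y - x))"
    have Dx: "(D x has_derivative D x) (at z within cball x (norm (y - x)))"
      using lin by (simp add: bounded_linear_imp_has_derivative linear_conv_bounded_linear)
    show "((\<lambda>y. \<Phi> y - D x y) has_derivative (\<lambda>v. D z v - D x v)) (at z within cball x (norm (y - x)))"
      by (intro has_derivative_diff has_derivative_at_withinI[OF D] Dx)
    show "onorm (\<lambda>v. D z v - D x v) \<le> L * norm (y - x)"
    proof (rule onorm_le)
      fix v
      have "norm (D z v - D x v) \<le> L * norm (z - x) * norm v"
        by (rule on)
      also have "\<dots> \<le> L * norm (y - x) * norm v"
        using z L0 by (intro mult_right_mono mult_left_mono) (auto simp: dist_norm norm_minus_commute)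
      finally show "norm (D z v - D x v) \<le> L * norm (y - x) * norm v" .
    qed
  qed (auto simp: dist_norm norm_minus_commute)
  then have "\<bar>\<Phi> y - \<Phi> x - D x (y - x)\<bar> \<le> L * norm (y - x) ^ 2" for x y
    unfolding linear_diff[OF lin] by (simp add: algebra_simps power2_eq_square)
  with L0 show ?thesis
    by blast
qed

lemma conv_integrable:
  fixes g :: "'a \<Rightarrow> complex"
  assumes "integrable lebesgue g" "bumps S \<Phi>"
  shows "integrable lebesgue (\<lambda>y. \<Phi> (x - y) *\<^sub>R g y)"
proof -
  obtain B where B: "\<And>x. \<bar>\<Phi> x\<bar> \<le> B"
    using bumps_bounded[OF assms(2)] by blast
  have "continuous_on UNIV (\<lambda>y. \<Phi> (x - y))"
    by (intro continuous_on_compose2[OF bumps_continuous[OF assms(2)]] continuous_intros) auto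
  then have [measurable]: "(\<lambda>y. \<Phi> (x - y)) \<in> borel_measurable lebesgue"
    by (intro measurable_completion) (simp add: borel_measurable_continuous_onI)
  have [measurable]: "g \<in> borel_measurable lebesgue"
    using assms(1) by auto
  show ?thesis
  proof (rule Bochner_Integration.integrable_bound[of lebesgue "\<lambda>y. B *\<^sub>R g y"])
    show "AE y in lebesgue. norm (\<Phi> (x - y) *\<^sub>R g y) \<le> norm (B *\<^sub>R g y)"
    proof (rule AE_I2)
      fix y
      have "\<bar>\<Phi> (x - y)\<bar> \<le> \<bar>B\<bar>"
        using B[of "x - y"] by linarith
      then show "norm (\<Phi> (x - y) *\<^sub>R g y) \<le> norm (B *\<^sub>R g y)"
        by (simp add: mult_right_mono)
    qed
  qed (use assms(1) in auto)
qed

text \<open>The quadratic remainder, integrated against \<open>g\<close>, is at most a multiple of the \<open>L\<^sup>1\<close> norm of \<open>g\<close>.\<close>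

lemma conv_deriv:
  assumes g: "integrable lebesgue g" and \<Phi>: "bumps S \<Phi>"
    and D: "\<And>x. (\<Phi> has_derivative D x) (at x)" and b: "\<And>v. bumps S (\<lambda>x. D x v)"
  shows "(conv \<Phi> g has_derivative (\<lambda>v. conv (\<lambda>u. D u v) g x)) (at x)"
proof -
  obtain C where C0: "C \<ge> 0" and C: "\<And>x y. \<bar>\<Phi> y - \<Phi> x - D x (y - x)\<bar> \<le> C * norm (y - x) ^ 2"
    using bumps_remainder[OF D b] by blast
  define G where "G = (LINT y|lebesgue. norm (g y))"
  have int: "integrable lebesgue (\<lambda>y. D (x - y) v *\<^sub>R g y)" for x v
    using conv_integrable[OF g b] .
  have lin: "linear (D x)" for x
    using D has_derivative_linear by blast
  have "linear (\<lambda>v. conv (\<lambda>u. D u v) g x)"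
  proof (rule linearI)
    show "conv (\<lambda>u. D u (v + w)) g x = conv (\<lambda>u. D u v) g x + conv (\<lambda>u. D u w) g x" for v w
      unfolding conv_def by (simp add: linear_add[OF lin] scaleR_add_left int)
    show "conv (\<lambda>u. D u (c *\<^sub>R v)) g x = c *\<^sub>R conv (\<lambda>u. D u v) g x" for c v
      unfolding conv_def by (simp add: linear_scale[OF lin] scaleR_scaleR[symmetric] del: scaleR_scaleR)
  qed
  then have bl: "bounded_linear (\<lambda>v. conv (\<lambda>u. D u v) g x)"
    by (simp add: linear_conv_bounded_linear)
  show ?thesis
  proof (rule has_derivativeI_sandwich[where e = 1 and H = "\<lambda>y. C * G * norm (y - x)"])
    show "((\<lambda>y. C * G * norm (y - x)) \<longlongrightarrow> 0) (at x)"
      by (auto intro!: tendsto_eq_intros)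
    fix z assume "z \<noteq> x"
    have "conv \<Phi> g z - conv \<Phi> g x - conv (\<lambda>u. D u (z - x)) g x
      = (LINT y|lebesgue. (\<Phi> (z - y) - \<Phi> (x - y) - D (x - y) (z - x)) *\<^sub>R g y)"
      unfolding conv_def scaleR_diff_left
      by (simp add: conv_integrable[OF g] int \<Phi> Bochner_Integration.integral_diff)
    also have "norm \<dots> \<le> (LINT y|lebesgue. C * norm (z - x) ^ 2 * norm (g y))"
    proof (rule Bochner_Integration.integral_norm_bound_integral)
      show "integrable lebesgue (\<lambda>y. (\<Phi> (z - y) - \<Phi> (x - y) - D (x - y) (z - x)) *\<^sub>R g y)"
        unfolding scaleR_diff_left by (intro Bochner_Integration.integrable_diff conv_integrable[OF g] int \<Phi>)
      show "integrable lebesgue (\<lambda>y. C * norm (z - x) ^ 2 * norm (g y))"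
        using g by simp
      fix y
      show "norm ((\<Phi> (z - y) - \<Phi> (x - y) - D (x - y) (z - x)) *\<^sub>R g y) \<le> C * norm (z - x) ^ 2 * norm (g y)"
        using C[of "z - y" "x - y"] by (auto intro!: mult_right_mono)
    qed
    also have "\<dots> = C * G * norm (z - x) ^ 2"
      by (simp add: G_def)
    finally show "norm (conv \<Phi> g z - conv \<Phi> g x - conv (\<lambda>u. D u (z - x)) g x) / norm (z - x) \<le> C * G * norm (z - x)"
      using \<open>z \<noteq> x\<close> by (simp add: divide_le_eq power2_eq_square mult.assoc)
  qed (use bl in auto)
qed

text \<open>Each directional derivative of a convolution is the convolution with another member of the class, so
  the induction on the order never leaves convolutions with \<open>g\<close>.\<close>

lemma conv_continuously_differentiable:
  assumes g: "integrable lebesgue g" and "bumps S \<Phi>"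
  shows "continuously_differentiable k (conv \<Phi> g)"
  using assms(2)
proof (induction k arbitrary: \<Phi>)
  case (0 \<Phi>)
  obtain D where "\<And>x. (\<Phi> has_derivative D x) (at x)" "\<And>v. bumps S (\<lambda>x. D x v)"
    using bumps_deriv[OF S 0] by blast
  from has_derivative_continuous[OF conv_deriv[OF g 0 this]] show ?case
    by (simp add: continuous_at_imp_continuous_on)
next
  case (Suc k \<Phi>)
  obtain D where D: "\<And>x. (\<Phi> has_derivative D x) (at x)" "\<And>v. bumps S (\<lambda>x. D x v)"
    using bumps_deriv[OF S Suc.prems] by blast
  note der = conv_deriv[OF g Suc.prems D]
  have "frechet_derivative (conv \<Phi> g) (at x) = (\<lambda>v. conv (\<lambda>u. D u v) g x)" for x
    by (rule frechet_derivative_at[OF der, symmetric])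
  moreover have "conv \<Phi> g differentiable at x" for x
    using der by (rule differentiableI)
  ultimately show ?case
    using Suc.IH D(2) by simp
qed

end

section \<open>Mollification at a small scale\<close>

lemma
  fixes g :: "'a::euclidean_space \<Rightarrow> 'b::{banach, second_countable_topology}"
  assumes "\<bar>c\<bar> = (1::real)"
  shows lebesgue_integral_affine_isometry: "(LINT y|lebesgue. g (t + c *\<^sub>R y)) = (LINT y|lebesgue. g y)"
    and lebesgue_integrable_affine_isometry: "integrable lebesgue g \<Longrightarrow> integrable lebesgue (\<lambda>y. g (t + c *\<^sub>R y))"
proof -
  let ?T = "\<lambda>x. t + (\<Sum>j\<in>Basis. (c * (x \<bullet> j)) *\<^sub>R j)"
  have T: "?T = (\<lambda>x. t + c *\<^sub>R x)"
    by (simp add: scaleR_sum_right[symmetric] scaleR_scaleR[symmetric] euclidean_representation del: scaleR_scaleR)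
  have c: "c \<noteq> 0"
    using assms by auto
  have meas: "(\<lambda>x. t + c *\<^sub>R x) \<in> lebesgue \<rightarrow>\<^sub>M lebesgue"
    using lebesgue_affine_measurable[of "\<lambda>_. c" t] c unfolding T by simp
  have "lebesgue = distr lebesgue lebesgue (\<lambda>x. t + c *\<^sub>R x)"
    using lebesgue_affine_euclidean[of "\<lambda>_. c" t] c assms unfolding T by (simp add: density_1)
  note eq = this[symmetric]
  show "(LINT y|lebesgue. g (t + c *\<^sub>R y)) = (LINT y|lebesgue. g y)"
  proof (cases "g \<in> borel_measurable lebesgue")
    case True
    from integral_distr[OF meas this] show ?thesis
      by (simp add: eq)
  next
    \<comment> \<open>Integrals of functions that are not integrable are 0, and measurability is preserved
      in both directions.\<close>
    case False
    have "\<not> integrable lebesgue (\<lambda>y. g (t + c *\<^sub>R y))"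
    proof
      assume "integrable lebesgue (\<lambda>y. g (t + c *\<^sub>R y))"
      then have "(\<lambda>y. g (t + c *\<^sub>R y)) \<in> borel_measurable lebesgue"
        by auto
      moreover have "(\<lambda>x. (- (1 / c)) *\<^sub>R t + (1 / c) *\<^sub>R x) \<in> lebesgue \<rightarrow>\<^sub>M (lebesgue :: 'a measure)"
      proof -
        have "(\<lambda>x. (- (1 / c)) *\<^sub>R t + (\<Sum>j\<in>Basis. ((1 / c) * (x \<bullet> j)) *\<^sub>R j)) \<in> lebesgue \<rightarrow>\<^sub>M (lebesgue :: 'a measure)"
          using lebesgue_affine_measurable[of "\<lambda>_. 1 / c" "(- (1 / c)) *\<^sub>R t"] c by simp
        then show ?thesis
          by (simp only: scaleR_scaleR[symmetric] scaleR_sum_right[symmetric] euclidean_representation)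
      qed
      ultimately have "(\<lambda>x. g (t + c *\<^sub>R ((- (1 / c)) *\<^sub>R t + (1 / c) *\<^sub>R x))) \<in> borel_measurable lebesgue"
        by (rule measurable_compose[rotated])
      with False c show False
        by (simp add: scaleR_add_right scaleR_diff_right)
    qed
    moreover have "\<not> integrable lebesgue g"
      using False by auto
    ultimately show ?thesis
      by (simp add: not_integrable_integral_eq)
  qed
  show "integrable lebesgue (\<lambda>y. g (t + c *\<^sub>R y))" if "integrable lebesgue g"
    using integrable_distr[OF meas, of g] that by (simp add: eq)
qed

text \<open>Used with a kernel of integral 1 (closeness of the mollification to an average) and with a
  difference of two such kernels, of integral 0 (variation of the mollification). In both
  cases subtracting the contribution of a constant \<open>a\<close> leaves the integral of the kernel against
  \<open>g - a\<close>.\<close>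

lemma kernel_average:
  fixes k :: "real ^ 'n \<Rightarrow> real" and g :: "real ^ 'n \<Rightarrow> complex"
  assumes g: "locally_integrable g" and kg: "integrable lebesgue (\<lambda>u. k u *\<^sub>R g u)"
    and k: "integrable lebesgue k" "\<And>u. \<bar>k u\<bar> \<le> b" "\<And>u. u \<notin> bbox \<beta> x m \<Longrightarrow> k u = 0"
  shows "cmod ((LINT u|lebesgue. k u *\<^sub>R g u) - (LINT u|lebesgue. k u) *\<^sub>R a) \<le> b * dev \<beta> g a x m"
proof -
  have "(LINT u|lebesgue. k u *\<^sub>R g u) - (LINT u|lebesgue. k u) *\<^sub>R a =
      (LINT u|lebesgue. k u *\<^sub>R g u - k u *\<^sub>R a)"
    using k(1) kg by simp
  also have "cmod \<dots> \<le> (LINT u|lebesgue. b * (indicat_real (bbox \<beta> x m) u *\<^sub>R cmod (g u - a)))"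
  proof (rule Bochner_Integration.integral_norm_bound_integral)
    show "integrable lebesgue (\<lambda>u. k u *\<^sub>R g u - k u *\<^sub>R a)"
      using k(1) kg by simp
    show "integrable lebesgue (\<lambda>u. b * (indicat_real (bbox \<beta> x m) u *\<^sub>R cmod (g u - a)))"
      using dev_integrable[OF g, of \<beta> x m a] by (simp add: set_integrable_def)
    fix u
    show "cmod (k u *\<^sub>R g u - k u *\<^sub>R a) \<le> b * (indicat_real (bbox \<beta> x m) u *\<^sub>R cmod (g u - a))"
      using k(2)[of u] k(3)[of u]
      by (auto simp: indicator_def scaleR_diff_right[symmetric] mult_right_mono simp del: scaleR_diff_right)
  qed
  finally show ?thesis
    by (simp add: dev_def set_lebesgue_integral_def)
qed

context low_exponents
begin

text \<open>The rescaling that takes the box \<open>B 0 d\<close> to the cube \<open>[-1, 1]\<close> in every coordinate, which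
  contains the unit ball.\<close>

definition resc :: "real \<Rightarrow> real ^ 'n \<Rightarrow> real ^ 'n" where
  "resc d x = (\<chi> i. 2 * x $ i / d powr \<beta> $ i)"

lemma bounded_linear_resc: "bounded_linear (resc d)"
proof -
  have "linear (resc d)"
    by (rule linearI) (auto simp: resc_def vec_eq_iff algebra_simps add_divide_distrib)
  then show ?thesis
    by (simp add: linear_conv_bounded_linear)
qed

lemma resc_coercive: 
  assumes "d > 0" "norm x \<ge> (\<Sum>i\<in>UNIV. d powr \<beta> $ i / 2)"
  shows "norm (resc d x) \<ge> 1"
proof (rule ccontr)
  assume "\<not> ?thesis"
  then have 1: "norm (resc d x) < 1"
    by simp
  have "\<bar>x $ i\<bar> < d powr \<beta> $ i / 2" for i
  proof -
    have "\<bar>resc d x $ i\<bar> < 1"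
      using component_le_norm_cart[of "resc d x" i] 1 by linarith
    then show ?thesis
      using assms(1) by (simp add: resc_def divide_less_eq abs_mult)
  qed
  then have "(\<Sum>i\<in>UNIV. \<bar>x $ i\<bar>) < (\<Sum>i\<in>UNIV. d powr \<beta> $ i / 2)"
    by (intro sum_strict_mono) auto
  with norm_le_l1_cart[of x] assms(2) show False
    by simp
qed

lemma mem_bbox_of_resc:
  assumes "d > 0" "norm (resc d (y - u)) < 1"
  shows "u \<in> B y d"
  unfolding mem_bbox
proof
  fix i
  have "\<bar>resc d (y - u) $ i\<bar> < 1"
    using component_le_norm_cart[of "resc d (y - u)" i] assms(2) by linarith
  then have "\<bar>2 * (y $ i - u $ i)\<bar> < d powr \<beta> $ i"
    using assms(1) by (simp add: resc_def divide_less_eq)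
  then show "\<bar>u $ i - y $ i\<bar> \<le> d powr \<beta> $ i / 2"
    by (simp add: abs_if split: if_splits)
qed

lemma norm_resc_le:
  assumes "0 < l" "l \<le> d" "\<And>i. \<bar>x $ i\<bar> \<le> l powr \<beta> $ i / 2"
  shows "norm (resc d x) \<le> real CARD('n) * (l / d) powr \<gamma>"
proof -
  have "norm (resc d x) \<le> (\<Sum>i\<in>UNIV. \<bar>resc d x $ i\<bar>)"
    by (rule norm_le_l1_cart)
  also have "\<dots> \<le> (\<Sum>i\<in>(UNIV::'n set). (l / d) powr \<gamma>)"
  proof (rule sum_mono)
    fix i
    have "\<bar>resc d x $ i\<bar> \<le> (l / d) powr \<beta> $ i"
      using assms(3)[of i] assms(1,2) by (simp add: resc_def abs_mult powr_divide divide_right_mono)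
    also have "\<dots> \<le> (l / d) powr \<gamma>"
      using assms by (intro powr_mono' minexp_le) auto
    finally show "\<bar>resc d x $ i\<bar> \<le> (l / d) powr \<gamma>" .
  qed
  finally show ?thesis
    by simp
qed

definition bump :: "real ^ 'n \<Rightarrow> real" where
  "bump x = bumpfun 0 (1 - x \<bullet> x)"

lemma bumps_bump: "bumps (resc d) (\<lambda>x. bump (resc d x))"
  unfolding bump_def by (rule bumps.base)

lemma bump_bounds: "0 \<le> bump x" "bump x \<le> 1"
  by (auto simp: bump_def bumpfun_def)

lemma bump_lipschitz: "\<exists>L\<ge>0. \<forall>x y. \<bar>bump x - bump y\<bar> \<le> L * norm (x - y)"
proof (rule bumps_lipschitz[of "\<lambda>x. x" 1])
  show "bumps (\<lambda>x. x) bump"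
    using bumps.base[of "\<lambda>x. x" 0] unfolding bump_def[abs_def] by simp
qed auto

text \<open>A lower bound for the integral of the bump at scale \<open>d = 1\<close>: its value at distance \<open>1 / 2\<close> from the
  origin, times the volume of a box whose rescaled points have norm at most \<open>1 / 2\<close>.\<close>

definition bump_mass :: real where
  "bump_mass = exp (- 4 / 3) * ((1 / (2 * real CARD('n))) powr (1 / \<gamma>)) powr s"

lemma bump_mass_pos: "bump_mass > 0"
  by (simp add: bump_mass_def)

lemma bump_resc_integrable:
  assumes "d > 0"
  shows "integrable lebesgue (\<lambda>u. bump (resc d (y - u)))"
    and "(LINT u|lebesgue. bump (resc d (y - u))) = (LINT u|lebesgue. bump (resc d u))"
    and "(LINT u|lebesgue. bump (resc d u)) \<ge> bump_mass * d powr s"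
proof -
  have cont: "continuous_on UNIV (\<lambda>u. bump (resc d u))"
    by (rule bumps_continuous[OF bounded_linear_resc resc_coercive[OF assms] bumps_bump])
  have supp: "bump (resc d u) = 0" if "u \<notin> B 0 d" for u
  proof -
    have "norm (resc d u) \<ge> 1"
    proof (rule ccontr)
      assume "\<not> ?thesis"
      moreover have "resc d (0 - u) = - resc d u"
        by (simp add: resc_def vec_eq_iff)
      ultimately have "u \<in> B 0 d"
        by (intro mem_bbox_of_resc[OF assms]) simp
      with that show False
        by simp
    qed
    with bumps_support[OF bumps_bump] show ?thesis
      by blast
  qed
  have int: "integrable lebesgue (\<lambda>u. bump (resc d u))"
  proof -
    have "integrable lborel (\<lambda>u. indicator (B 0 d) u *\<^sub>R bump (resc d u))"
      by (intro borel_integrable_compact continuous_on_subset[OF cont]) auto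
    also have "(\<lambda>u. indicator (B 0 d) u *\<^sub>R bump (resc d u)) = (\<lambda>u. bump (resc d u))"
      using supp by (auto simp: indicator_def fun_eq_iff)
    finally show ?thesis
      by (rule integrable_completion[THEN iffD2, rotated]) (use cont in \<open>simp add: borel_measurable_continuous_onI\<close>)
  qed
  show "integrable lebesgue (\<lambda>u. bump (resc d (y - u)))"
    using lebesgue_integrable_affine_isometry[of "- 1" "\<lambda>u. bump (resc d u)" y] int by simp
  show "(LINT u|lebesgue. bump (resc d (y - u))) = (LINT u|lebesgue. bump (resc d u))"
    using lebesgue_integral_affine_isometry[of "- 1" "\<lambda>u. bump (resc d u)" y] by simp
  have "CARD('n) \<ge> 1"
    using zero_less_card_finite[where 'a = 'n] by linarith
  then have n1: "real CARD('n) \<ge> 1"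
    by simp
  define \<tau> where "\<tau> = (1 / (2 * real CARD('n))) powr (1 / \<gamma>)"
  have \<tau>: "0 < \<tau>" "\<tau> \<le> 1"
  proof -
    define m where "m = real CARD('n)"
    have "m \<ge> 1"
      unfolding m_def by (rule n1)
    then show "0 < \<tau>" "\<tau> \<le> 1"
      unfolding \<tau>_def m_def[symmetric] using minexp_pos by (auto intro!: powr_le1)
  qed
  have low: "bump (resc d u) \<ge> exp (- 4 / 3)" if "u \<in> B 0 (\<tau> * d)" for u
  proof -
    have "norm (resc d u) \<le> real CARD('n) * (\<tau> * d / d) powr \<gamma>"
      using that \<tau> assms by (intro norm_resc_le) (auto simp: mem_bbox)
    also have "\<dots> = 1 / 2"
      using assms minexp_pos by (simp add: \<tau>_def powr_powr)
    finally have "norm (resc d u) ^ 2 \<le> (1 / 2) ^ 2"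
      by (intro power_mono) auto
    then have q: "resc d u \<bullet> resc d u \<le> 1 / 4"
      by (simp add: dot_square_norm power2_eq_square)
    then have "exp (- 4 / 3) \<le> exp (- 1 / (1 - resc d u \<bullet> resc d u))"
      by (simp add: field_simps)
    with q show ?thesis
      by (simp add: bump_def bumpfun_def)
  qed
  have "bump_mass * d powr s = (LINT u:B 0 (\<tau> * d)|lebesgue. exp (- 4 / 3))"
    using \<tau> assms by (subst LINT_const_bbox) (auto simp: bump_mass_def \<tau>_def powr_mult)
  also have "\<dots> \<le> (LINT u|lebesgue. bump (resc d u))"
    unfolding set_lebesgue_integral_def
  proof (rule integral_mono[OF _ int])
    show "integrable lebesgue (\<lambda>u. indicat_real (B 0 (\<tau> * d)) u *\<^sub>R exp (- 4 / 3 :: real))"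
      using set_integrable_const_bbox[of \<beta> 0 "\<tau> * d" "exp (- 4 / 3 :: real)"] by (simp add: set_integrable_def)
  qed (use low bump_bounds in \<open>auto simp: indicator_def\<close>)
  finally show "(LINT u|lebesgue. bump (resc d u)) \<ge> bump_mass * d powr s" .
qed

text \<open>The approximant is the convolution with the normalised bump of scale \<open>d = d0 / K\<close>; the factor \<open>K\<close> leaves
  the boxes of side \<open>K * d\<close>, which contain the supports of the kernels involved, within the range of
  the hypothesis. The constant is chosen before \<open>g\<close> and \<open>\<epsilon>\<close>, as \<open>g\<close> will depend on \<open>\<epsilon>\<close>.\<close>

lemma mollify:
  obtains C where "C \<ge> 0" and "\<And>g d0 N \<epsilon>. \<lbrakk>integrable lebesgue g; N > 0; \<And>x. x \<notin> B 0 N \<Longrightarrow> g x = 0;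
      d0 > 0; \<epsilon> \<ge> 0; \<And>x l. \<lbrakk>0 < l; l \<le> d0\<rbrakk> \<Longrightarrow> osc \<beta> \<alpha> g (B x l) \<le> \<epsilon>\<rbrakk> \<Longrightarrow>
    \<exists>h. test_function h \<and> (\<forall>x l. l > 0 \<longrightarrow> osc \<beta> \<alpha> (\<lambda>x. g x - h x) (B x l) \<le> C * \<epsilon>)"
proof -
  obtain L where L: "L \<ge> 0" "\<And>x y. \<bar>bump x - bump y\<bar> \<le> L * norm (x - y)"
    using bump_lipschitz by metis
  let ?n = "real CARD('n)" and ?m = bump_mass
  define C where "C = 1 + 2 * (L * ?n * K powr p / ?m) + 2 * (2 ^ CARD('n) * K powr p * (1 + 1 / ?m))"
  have C0: "C \<ge> 0" "L * ?n * K powr p / ?m \<ge> 0" "2 ^ CARD('n) * K powr p * (1 + 1 / ?m) \<ge> 0"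
    using L bump_mass_pos by (auto simp: C_def)
  have K: "K > 0" "K \<ge> 1"
    using dil_gt1 by auto
  have main: "\<exists>h. test_function h \<and> (\<forall>x l. l > 0 \<longrightarrow> osc \<beta> \<alpha> (\<lambda>x. g x - h x) (B x l) \<le> C * \<epsilon>)"
    if g: "integrable lebesgue g" and N: "N > 0" and supp: "\<And>x. x \<notin> B 0 N \<Longrightarrow> g x = 0"
    and d0: "d0 > 0" and \<epsilon>: "\<epsilon> \<ge> 0" and small: "\<And>x l. 0 < l \<Longrightarrow> l \<le> d0 \<Longrightarrow> osc \<beta> \<alpha> g (B x l) \<le> \<epsilon>"
    for g d0 N \<epsilon>
  proof -
    have g_loc: "locally_integrable g"
      by (rule locally_integrable_integrable[OF g])
    define d where "d = d0 / K"
    have d: "d > 0" "K * d = d0" "d \<le> d0"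
      using d0 K by (auto simp: d_def divide_le_eq)
    have Kd: "K * d > 0"
      using d K by simp
    define w where "w = (LINT u|lebesgue. bump (resc d u))"
    have w_ge: "w \<ge> ?m * d powr s"
      unfolding w_def by (rule bump_resc_integrable(3)[OF d(1)])
    have md: "?m * d powr s > 0"
      using bump_mass_pos d by simp
    have w: "w > 0"
      using w_ge md by linarith
    have w_le: "X / w \<le> X / (?m * d powr s)" if "X \<ge> 0" for X
      using that w_ge md by (intro divide_left_mono) auto
    define \<Phi> where "\<Phi> x = 1 / w * bump (resc d x)" for x
    have bumps: "bumps (resc d) \<Phi>"
      unfolding \<Phi>_def by (intro bumps.scale bumps_bump)
    define h where "h = conv \<Phi> g"
    have h_eq: "h y = (LINT u|lebesgue. \<Phi> (y - u) *\<^sub>R g u)" for y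
      by (simp add: h_def conv_def)
    note resc = bounded_linear_resc[of d] resc_coercive[OF d(1)]
    have \<Phi>g: "integrable lebesgue (\<lambda>u. \<Phi> (y - u) *\<^sub>R g u)" for y
      by (rule conv_integrable[OF resc g bumps])
    have \<Phi>_int: "integrable lebesgue (\<lambda>u. \<Phi> (y - u))" for y
      unfolding \<Phi>_def using bump_resc_integrable(1)[OF d(1)] by simp
    have \<Phi>_1: "(LINT u|lebesgue. \<Phi> (y - u)) = 1" for y
      unfolding \<Phi>_def using bump_resc_integrable(2)[OF d(1), of y] w by (simp add: w_def)
    have \<Phi>_supp: "\<Phi> (y - u) = 0" if "u \<notin> B y d" for y u
      using bumps_support[OF bumps, of "y - u"] mem_bbox_of_resc[OF d(1), of y u] that by fastforce
    have smooth: "continuously_differentiable k h" for k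
      unfolding h_def by (rule conv_continuously_differentiable[OF resc g bumps])
    have h_cont: "continuous_on UNIV h"
      using smooth[of 0] by simp
    have h_loc: "locally_integrable h"
      by (rule locally_integrable_continuous[OF h_cont])
    have gh_loc: "locally_integrable (\<lambda>x. g x - h x)"
      by (rule locally_integrable_diff[OF g_loc h_loc])
    have "compact (closure {x. h x \<noteq> 0})"
    proof -
      define m where "m = max N d"
      have m: "m > 0" "N \<le> m" "d \<le> m"
        using N by (auto simp: m_def)
      have "{x. h x \<noteq> 0} \<subseteq> B 0 (K * m)"
      proof
        fix y assume "y \<in> {x. h x \<noteq> 0}"
        then have "h y \<noteq> 0"
          by simp
        have "\<exists>u. \<Phi> (y - u) *\<^sub>R g u \<noteq> 0"
        proof (rule ccontr)
          assume "\<not> ?thesis"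
          then have "(\<lambda>u. \<Phi> (y - u) *\<^sub>R g u) = (\<lambda>u. 0)"
            by blast
          then have "h y = 0"
            unfolding h_eq by simp
          with \<open>h y \<noteq> 0\<close> show False ..
        qed
        then obtain u where "\<Phi> (y - u) \<noteq> 0" "g u \<noteq> 0"
          by auto
        then have u: "u \<in> B y d" "u \<in> B 0 m"
          using \<Phi>_supp supp bbox_mono[OF N m(2)] by blast+
        have "B y d \<subseteq> B 0 (K * m)"
          by (rule bbox_subset_dil[OF d(1) m(3) u])
        moreover have "y \<in> B y d"
          by (simp add: mem_bbox)
        ultimately show "y \<in> B 0 (K * m)"
          by blast
      qed
      then show ?thesis
        by (meson bounded_subset compact_bbox compact_closure compact_imp_bounded)
    qed
    then have test: "test_function h"
      using smooth by (simp add: test_function_def)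
    have near: "B y d \<subseteq> B x (K * d)" if "y \<in> B x d" for x y
      using that by (intro bbox_subset_dil[OF d(1) order_refl, of y]) (simp_all add: mem_bbox)
    have dev: "dev \<beta> g (avg \<beta> g x (K * d)) x (K * d) \<le> \<epsilon> * K powr p * d powr p" for x
    proof -
      have "osc \<beta> \<alpha> g (B x (K * d)) \<le> \<epsilon>"
        by (rule small[OF Kd]) (simp add: d)
      then have "dev \<beta> g (avg \<beta> g x (K * d)) x (K * d) \<le> \<epsilon> * (K * d) powr p"
        using osc_le_iff[OF Kd] by blast
      also have "\<dots> = \<epsilon> * K powr p * d powr p"
        using d(1) K by (simp add: powr_mult)
      finally show ?thesis .
    qed
    have dev0: "\<epsilon> * K powr p * d powr p \<ge> 0"
      using \<epsilon> by simp
    have dp: "d powr p = d powr \<alpha> * d powr s"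
      by (simp add: powr_add)
    \<comment> \<open>A kernel of integral 1: \<open>h\<close> is close to the average of \<open>g\<close> over the surrounding box.\<close>
    have h_near: "cmod (h y - avg \<beta> g x (K * d)) \<le> \<epsilon> * K powr p * d powr \<alpha> / ?m" if y: "y \<in> B x d" for x y
    proof -
      have "cmod ((LINT u|lebesgue. \<Phi> (y - u) *\<^sub>R g u) - (LINT u|lebesgue. \<Phi> (y - u)) *\<^sub>R avg \<beta> g x (K * d)) \<le>
        1 / w * dev \<beta> g (avg \<beta> g x (K * d)) x (K * d)"
      proof (rule kernel_average[OF g_loc \<Phi>g \<Phi>_int])
        show "\<bar>\<Phi> (y - u)\<bar> \<le> 1 / w" for u
          using w bump_bounds[of "resc d (y - u)"] by (simp add: \<Phi>_def divide_right_mono)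
      qed (use \<Phi>_supp near[OF y] in blast)
      also have "\<dots> \<le> \<epsilon> * K powr p * d powr p / w"
        using dev[of x] w by (simp add: divide_right_mono)
      also have "\<dots> \<le> \<epsilon> * K powr p * d powr p / (?m * d powr s)"
        by (rule w_le[OF dev0])
      also have "\<dots> = \<epsilon> * K powr p * d powr \<alpha> / ?m"
        using d by (simp add: dp)
      finally show ?thesis
        by (simp add: h_eq \<Phi>_1)
    qed
    \<comment> \<open>A kernel of integral 0, of size \<open>(l / d) powr \<gamma>\<close> relative to the previous one.\<close>
    have h_lip: "cmod (h y - h x) \<le> L * ?n * K powr p / ?m * \<epsilon> * l powr \<alpha>"
      if l: "0 < l" "l \<le> d" and y: "y \<in> B x l" for x y l
    proof -
      define \<theta> where "\<theta> = (l / d) powr \<gamma>"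
      have yd: "y \<in> B x d" "x \<in> B x d"
        using y bbox_mono[OF l, of x] by (blast, simp add: mem_bbox)
      let ?k = "\<lambda>u. \<Phi> (y - u) - \<Phi> (x - u)"
      have "cmod ((LINT u|lebesgue. ?k u *\<^sub>R g u) - (LINT u|lebesgue. ?k u) *\<^sub>R avg \<beta> g x (K * d)) \<le>
        (L * (?n * \<theta>)) / w * dev \<beta> g (avg \<beta> g x (K * d)) x (K * d)"
      proof (rule kernel_average[OF g_loc])
        show "integrable lebesgue (\<lambda>u. ?k u *\<^sub>R g u)"
          unfolding scaleR_diff_left by (intro Bochner_Integration.integrable_diff \<Phi>g)
        show "integrable lebesgue ?k"
          by (intro Bochner_Integration.integrable_diff \<Phi>_int)
        show "\<bar>?k u\<bar> \<le> L * (?n * \<theta>) / w" for u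
        proof -
          have "\<bar>bump (resc d (y - u)) - bump (resc d (x - u))\<bar> \<le> L * norm (resc d (y - u) - resc d (x - u))"
            by (rule L)
          also have "resc d (y - u) - resc d (x - u) = resc d (y - x)"
            using linear_diff[OF bounded_linear.linear[OF bounded_linear_resc]] by simp
          also have "L * norm (resc d (y - x)) \<le> L * (?n * \<theta>)"
            unfolding \<theta>_def using y L by (intro mult_left_mono norm_resc_le l) (auto simp: mem_bbox)
          finally show ?thesis
            using w by (simp add: \<Phi>_def diff_divide_distrib[symmetric] abs_divide divide_right_mono)
        qed
        show "?k u = 0" if "u \<notin> B x (K * d)" for u
          using that near[OF yd(1)] near[OF yd(2)] \<Phi>_supp by (metis diff_self subsetD)
      qed
      moreover have "(LINT u|lebesgue. ?k u *\<^sub>R g u) = h y - h x"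
        unfolding h_eq scaleR_diff_left by (rule Bochner_Integration.integral_diff[OF \<Phi>g \<Phi>g])
      moreover have "(LINT u|lebesgue. ?k u) = 0"
        using Bochner_Integration.integral_diff[OF \<Phi>_int[of y] \<Phi>_int[of x]] by (simp add: \<Phi>_1)
      ultimately have "cmod (h y - h x) \<le> (L * (?n * \<theta>)) / w * dev \<beta> g (avg \<beta> g x (K * d)) x (K * d)"
        by simp
      also have "\<dots> \<le> (L * (?n * \<theta>)) / w * (\<epsilon> * K powr p * d powr p)"
        using L w by (intro mult_left_mono dev) (auto simp: \<theta>_def)
      also have "\<dots> = (L * (?n * \<theta>) * (\<epsilon> * K powr p * d powr p)) / w"
        by simp
      also have "\<dots> \<le> (L * (?n * \<theta>) * (\<epsilon> * K powr p * d powr p)) / (?m * d powr s)"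
        using L \<epsilon> by (intro w_le mult_nonneg_nonneg) (auto simp: \<theta>_def)
      also have "\<dots> = L * ?n * K powr p / ?m * \<epsilon> * (\<theta> * d powr \<alpha>)"
        using d by (simp add: dp)
      also have "\<dots> \<le> L * ?n * K powr p / ?m * \<epsilon> * l powr \<alpha>"
      proof (rule mult_left_mono)
        have "\<theta> * d powr \<alpha> \<le> (l / d) powr \<alpha> * d powr \<alpha>"
          unfolding \<theta>_def using l d alpha by (intro mult_right_mono powr_mono') auto
        also have "\<dots> = l powr \<alpha>"
          using l d by (simp add: powr_divide)
        finally show "\<theta> * d powr \<alpha> \<le> l powr \<alpha>" .
      qed (rule mult_nonneg_nonneg[OF C0(2) \<epsilon>])
      finally show ?thesis .
    qed
    have "osc \<beta> \<alpha> (\<lambda>x. g x - h x) (B x l) \<le> C * \<epsilon>" if l: "l > 0" for x l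
    proof (cases "l \<le> d")
      case True
      have "dev \<beta> h (h x) x l \<le> (LINT y:B x l|lebesgue. L * ?n * K powr p / ?m * \<epsilon> * l powr \<alpha>)"
        unfolding dev_def set_lebesgue_integral_def
      proof (rule integral_mono)
        show "integrable lebesgue (\<lambda>y. indicat_real (B x l) y *\<^sub>R cmod (h y - h x))"
          using dev_integrable[OF h_loc, of \<beta> x l "h x"] by (simp add: set_integrable_def)
        show "integrable lebesgue (\<lambda>y. indicat_real (B x l) y *\<^sub>R (L * ?n * K powr p / ?m * \<epsilon> * l powr \<alpha>))"
          using set_integrable_const_bbox[of \<beta> x l "L * ?n * K powr p / ?m * \<epsilon> * l powr \<alpha>"] by (simp add: set_integrable_def)
        show "indicat_real (B x l) y *\<^sub>R cmod (h y - h x) \<le>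
          indicat_real (B x l) y *\<^sub>R (L * ?n * K powr p / ?m * \<epsilon> * l powr \<alpha>)" for y
          using h_lip[OF l True, of y x] by (auto simp: indicator_def)
      qed
      also have "\<dots> = (L * ?n * K powr p / ?m * \<epsilon>) * l powr p"
        by (subst LINT_const_bbox[OF l]) (simp add: powr_add)
      finally have "osc \<beta> \<alpha> h (B x l) \<le> 2 * (L * ?n * K powr p / ?m * \<epsilon>)"
        by (rule osc_le_of_dev[OF h_loc l])
      moreover have "osc \<beta> \<alpha> g (B x l) \<le> \<epsilon>"
        using True d by (intro small l) auto
      ultimately have "osc \<beta> \<alpha> (\<lambda>x. g x - h x) (B x l) \<le> (1 + 2 * (L * ?n * K powr p / ?m)) * \<epsilon>"
        using osc_diff_le[OF g_loc h_loc l, of x] by (simp add: algebra_simps)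
      also have "\<dots> \<le> C * \<epsilon>"
        using C0 \<epsilon> by (intro mult_right_mono) (auto simp: C_def)
      finally show ?thesis .
    next
      case False
      then have dl: "d \<le> l"
        by simp
      define A where "A = \<epsilon> * K powr p * (1 + 1 / ?m) * d powr p"
      have cell: "(LINT y:B z d|lebesgue. cmod (g y - h y)) \<le> A" for z
      proof -
        let ?a = "avg \<beta> g z (K * d)" and ?e = "\<epsilon> * K powr p * d powr \<alpha> / ?m"
        have "(LINT y:B z d|lebesgue. cmod (g y - h y)) \<le> (LINT y:B z d|lebesgue. cmod (g y - ?a) + ?e)"
          unfolding set_lebesgue_integral_def
        proof (rule integral_mono)
          show "integrable lebesgue (\<lambda>y. indicat_real (B z d) y *\<^sub>R cmod (g y - h y))"
            using dev_integrable[OF gh_loc, of \<beta> z d 0] by (simp add: set_integrable_def)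
          show "integrable lebesgue (\<lambda>y. indicat_real (B z d) y *\<^sub>R (cmod (g y - ?a) + ?e))"
            using set_integral_add(1)[OF dev_integrable[OF g_loc] set_integrable_const_bbox] by (simp add: set_integrable_def)
          show "indicat_real (B z d) y *\<^sub>R cmod (g y - h y) \<le> indicat_real (B z d) y *\<^sub>R (cmod (g y - ?a) + ?e)" for y
            using h_near[of y z] norm_triangle_ineq4[of "g y - ?a" "h y - ?a"] by (auto simp: indicator_def)
        qed
        also have "\<dots> = dev \<beta> g ?a z d + d powr s * ?e"
          unfolding dev_def using LINT_const_bbox[OF d(1), of \<beta> z ?e]
          by (subst set_integral_add) (auto simp: dev_integrable[OF g_loc] set_integrable_const_bbox)
        also have "dev \<beta> g ?a z d \<le> dev \<beta> g ?a z (K * d)"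
          using d by (intro dev_mono g_loc bbox_mono) auto
        also have "\<dots> \<le> \<epsilon> * K powr p * d powr p"
          by (rule dev)
        finally show ?thesis
          by (simp add: A_def dp algebra_simps)
      qed
      have "dev \<beta> (\<lambda>x. g x - h x) 0 x l = (LINT y:B x l|lebesgue. cmod (g y - h y))"
        by (simp add: dev_def)
      also have "\<dots> \<le> 2 ^ CARD('n) * (l / d) powr s * A"
      proof (rule cover_integral[OF d(1) dl _ _ cell])
        show "set_integrable lebesgue (B x l) (\<lambda>y. cmod (g y - h y))" for x l
          using dev_integrable[OF gh_loc, of \<beta> x l 0] by simp
      qed simp
      also have "\<dots> = 2 ^ CARD('n) * K powr p * (1 + 1 / ?m) * \<epsilon> * (l powr s * d powr \<alpha>)"
        using d l by (simp add: A_def dp powr_divide)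
      also have "\<dots> \<le> 2 ^ CARD('n) * K powr p * (1 + 1 / ?m) * \<epsilon> * (l powr s * l powr \<alpha>)"
        using bump_mass_pos \<epsilon> d dl alpha0 by (intro mult_left_mono powr_mono2 mult_nonneg_nonneg) auto
      also have "l powr s * l powr \<alpha> = l powr p"
        by (simp add: powr_add)
      finally have "osc \<beta> \<alpha> (\<lambda>x. g x - h x) (B x l) \<le> 2 * (2 ^ CARD('n) * K powr p * (1 + 1 / ?m) * \<epsilon>)"
        by (rule osc_le_of_dev[OF gh_loc l])
      also have "\<dots> = (2 * (2 ^ CARD('n) * K powr p * (1 + 1 / ?m))) * \<epsilon>"
        by simp
      also have "\<dots> \<le> C * \<epsilon>"
        unfolding C_def using C0 \<epsilon> by (intro mult_right_mono) auto
      finally show ?thesis .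
    qed
    with test show ?thesis
      by blast
  qed
  show thesis
    by (rule that[OF C0(1) main])
qed

end

section \<open>Exponents that force constancy\<close>

lemma bbox_translate_integral:
  fixes F :: "real ^ 'n \<Rightarrow> 'b::{banach, second_countable_topology}"
  shows "(LINT y:bbox \<beta> x l|lebesgue. F (y + t)) = (LINT y:bbox \<beta> (x + t) l|lebesgue. F y)"
proof -
  have ind: "indicat_real (bbox \<beta> x l) y = indicat_real (bbox \<beta> (x + t) l) (t + y)" for y
    by (auto simp: indicator_def mem_bbox)
  have "(LINT y:bbox \<beta> x l|lebesgue. F (y + t)) =
      (LINT y|lebesgue. (\<lambda>y. indicat_real (bbox \<beta> (x + t) l) y *\<^sub>R F y) (t + 1 *\<^sub>R y))"
    unfolding set_lebesgue_integral_def ind by (simp add: add.commute)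
  also have "\<dots> = (LINT y:bbox \<beta> (x + t) l|lebesgue. F y)"
    unfolding set_lebesgue_integral_def by (rule lebesgue_integral_affine_isometry) simp
  finally show ?thesis .
qed

lemma locally_integrable_translate:
  assumes "locally_integrable f"
  shows "locally_integrable (\<lambda>y. f (y + t))"
  unfolding locally_integrable_def
proof (intro allI impI)
  fix C :: "(real ^ 'a) set" assume "compact C"
  then have "compact ((\<lambda>y. y + t) ` C)"
    by (intro compact_continuous_image continuous_intros)
  then have "integrable lebesgue (\<lambda>y. indicat_real ((\<lambda>y. y + t) ` C) y *\<^sub>R f y)"
    using assms by (simp add: locally_integrable_def set_integrable_def)
  from lebesgue_integrable_affine_isometry[of 1, OF _ this, of t]
  have "integrable lebesgue (\<lambda>y. indicat_real ((\<lambda>y. y + t) ` C) (t + y) *\<^sub>R f (t + y))"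
    by simp
  also have "(\<lambda>y. indicat_real ((\<lambda>y. y + t) ` C) (t + y) *\<^sub>R f (t + y)) = (\<lambda>y. indicat_real C y *\<^sub>R f (y + t))"
    by (auto simp: indicator_def fun_eq_iff add.commute)
  finally show "(\<lambda>y. f (y + t)) absolutely_integrable_on C"
    by (simp add: set_integrable_def)
qed

context exponents
begin

text \<open>Boxes of equal side whose centres differ by at most one edge length in each coordinate meet at
  the midpoint of the centres, so one dilated box contains both.\<close>

lemma average_neighbour:
  assumes f: "locally_integrable f" and A: "\<And>x l. l > 0 \<Longrightarrow> osc \<beta> \<alpha> f (B x l) \<le> A"
    and d: "d > 0" and xy: "\<And>i. \<bar>y $ i - x $ i\<bar> \<le> d powr \<beta> $ i"
  shows "cmod (avg \<beta> f x d - avg \<beta> f y d) \<le> 2 * A * K powr p * d powr \<alpha>"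
proof -
  have K: "K > 0" "K \<ge> 1"
    using dil_gt1 by auto
  have Kd: "K * d > 0"
    using K d by simp
  have dev: "dev \<beta> f (avg \<beta> f x (K * d)) x (K * d) \<le> A * (K * d) powr p"
    using osc_le_iff[OF Kd] A[OF Kd] by blast
  let ?z = "\<chi> i. (x $ i + y $ i) / 2"
  have zeq: "?z $ i - x $ i = (y $ i - x $ i) / 2" "?z $ i - y $ i = - ((y $ i - x $ i) / 2)" for i
    by (simp_all add: field_simps)
  have z: "?z \<in> B x d" "?z \<in> B y d"
    unfolding mem_bbox zeq abs_minus_cancel abs_divide using xy by auto
  have sub: "B x d \<subseteq> B x (K * d)" "B y d \<subseteq> B x (K * d)"
    by (rule bbox_subset_dil[OF d order_refl z(1) z(1)], rule bbox_subset_dil[OF d order_refl z(2) z(1)])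
  have eq: "A * (K * d) powr p / d powr s = A * K powr p * d powr \<alpha>"
    using K d by (simp add: powr_mult powr_add)
  have "dev \<beta> f (avg \<beta> f x (K * d)) x (K * d) / d powr s \<le> A * K powr p * d powr \<alpha>"
    unfolding eq[symmetric] using dev by (rule divide_right_mono) simp
  then show ?thesis
    using average_diff_dev[OF f d sub(1), of "avg \<beta> f x (K * d)"] average_diff_dev[OF f d sub(2), of "avg \<beta> f x (K * d)"]
      norm_triangle_ineq4[of "avg \<beta> f x d - avg \<beta> f x (K * d)" "avg \<beta> f y d - avg \<beta> f x (K * d)"]
    by simp
qed

text \<open>To move a box of side \<open>d\<close> by \<open>t\<close> in direction \<open>i\<close> takes about \<open>t / d powr \<beta> $ i\<close> steps of one edge
  length, and every step changes the average by at most a multiple of \<open>d powr \<alpha>\<close>.\<close>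

lemma average_axis:
  assumes f: "locally_integrable f" and A: "\<And>x l. l > 0 \<Longrightarrow> osc \<beta> \<alpha> f (B x l) \<le> A"
    and d: "d > 0" and t: "t \<ge> 0"
  shows "cmod (avg \<beta> f x d - avg \<beta> f (x + t *\<^sub>R axis i 1) d) \<le> (t / d powr \<beta> $ i + 1) * (2 * A * K powr p * d powr \<alpha>)"
proof -
  let ?D = "2 * A * K powr p * d powr \<alpha>"
  have "A \<ge> 0"
    using A[of 1 0] osc_nonneg[of \<beta> \<alpha> f "B 0 1"] by linarith
  then have D0: "?D \<ge> 0"
    by simp
  define m where "m = nat \<lfloor>t / d powr \<beta> $ i\<rfloor>"
  have q0: "t / d powr \<beta> $ i \<ge> 0"
    using t by simp
  have m: "real m \<le> t / d powr \<beta> $ i" "t / d powr \<beta> $ i < real m + 1"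
    unfolding m_def using q0 by linarith+
  define z where "z j = x + (real j * d powr \<beta> $ i) *\<^sub>R axis i 1" for j
  have step: "cmod (avg \<beta> f (z j) d - avg \<beta> f (z (Suc j)) d) \<le> ?D" for j
    by (rule average_neighbour[OF f A d]) (auto simp: z_def axis_def algebra_simps)
  have chain: "cmod (avg \<beta> f (z 0) d - avg \<beta> f (z j) d) \<le> real j * ?D" for j
  proof (induction j)
    case (Suc j)
    then show ?case
      using step[of j] norm_triangle_ineq[of "avg \<beta> f (z 0) d - avg \<beta> f (z j) d" "avg \<beta> f (z j) d - avg \<beta> f (z (Suc j)) d"]
      by (simp add: distrib_right)
  qed simp
  have "cmod (avg \<beta> f (z m) d - avg \<beta> f (x + t *\<^sub>R axis i 1) d) \<le> ?D"
  proof (rule average_neighbour[OF f A d])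
    fix k
    have "\<bar>t - real m * d powr \<beta> $ i\<bar> \<le> d powr \<beta> $ i"
      using m d by (simp add: field_simps abs_le_iff)
    then show "\<bar>(x + t *\<^sub>R axis i 1) $ k - z m $ k\<bar> \<le> d powr \<beta> $ k"
      by (auto simp: z_def axis_def)
  qed
  then have "cmod (avg \<beta> f x d - avg \<beta> f (x + t *\<^sub>R axis i 1) d) \<le> (real m + 1) * ?D"
    using chain[of m] norm_triangle_ineq[of "avg \<beta> f (z 0) d - avg \<beta> f (z m) d" "avg \<beta> f (z m) d - avg \<beta> f (x + t *\<^sub>R axis i 1) d"]
    by (simp add: z_def distrib_right)
  also have "\<dots> \<le> (t / d powr \<beta> $ i + 1) * ?D"
    using m D0 by (intro mult_right_mono) auto
  finally show ?thesis .
qed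

text \<open>On boxes of side \<open>d\<close> both \<open>f\<close> and its translate are close to their averages, and by \<open>average_axis\<close> these
  averages differ by at most a multiple of \<open>d powr \<alpha> + t * d powr (\<alpha> - \<beta> $ i)\<close>. Both exponents are positive, so
  the bound, transported to a fixed box by \<open>cover_integral\<close>, tends to 0 with \<open>d\<close>.\<close>

lemma translation_invariant:
  assumes f: "locally_integrable f" and A: "\<And>x l. l > 0 \<Longrightarrow> osc \<beta> \<alpha> f (B x l) \<le> A"
    and i: "\<beta> $ i < \<alpha>" and t: "t \<ge> 0" and l: "l > 0"
  shows "(LINT y:B x l|lebesgue. cmod (f y - f (y + t *\<^sub>R axis i 1))) \<le> 0"
proof -
  let ?e = "t *\<^sub>R axis i 1 :: real ^ 'n"
  have ft: "locally_integrable (\<lambda>y. f (y + ?e))"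
    by (rule locally_integrable_translate[OF f])
  note df = locally_integrable_diff[OF f ft]
  have cell: "(LINT y:B z d|lebesgue. cmod (f y - f (y + ?e))) \<le>
    d powr s * (2 * A * d powr \<alpha> + 2 * A * K powr p * (d powr \<alpha> + t * d powr (\<alpha> - \<beta> $ i)))" if d: "d > 0" for z d
  proof -
    let ?a = "avg \<beta> f z d" and ?b = "avg \<beta> f (z + ?e) d"
    have "(LINT y:B z d|lebesgue. cmod (f y - f (y + ?e))) \<le>
       (LINT y:B z d|lebesgue. (cmod (f y - ?a) + cmod (f (y + ?e) - ?b)) + cmod (?a - ?b))"
    proof (rule set_integral_mono)
      show "set_integrable lebesgue (B z d) (\<lambda>y. cmod (f y - f (y + ?e)))"
        using dev_integrable[OF df, of \<beta> z d 0] by simp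
      show "set_integrable lebesgue (B z d) (\<lambda>y. (cmod (f y - ?a) + cmod (f (y + ?e) - ?b)) + cmod (?a - ?b))"
        by (intro set_integral_add dev_integrable f ft set_integrable_const_bbox)
      fix y
      have "cmod (f y - f (y + ?e)) = cmod (((f y - ?a) - (f (y + ?e) - ?b)) + (?a - ?b))"
        by simp
      then show "cmod (f y - f (y + ?e)) \<le> (cmod (f y - ?a) + cmod (f (y + ?e) - ?b)) + cmod (?a - ?b)"
        using norm_triangle_ineq[of "(f y - ?a) - (f (y + ?e) - ?b)" "?a - ?b"] norm_triangle_ineq4[of "f y - ?a" "f (y + ?e) - ?b"]
        by linarith
    qed
    also have "\<dots> = dev \<beta> f ?a z d + dev \<beta> (\<lambda>y. f (y + ?e)) ?b z d + d powr s * cmod (?a - ?b)"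
      unfolding dev_def using LINT_const_bbox[OF d, of \<beta> z "cmod (?a - ?b)"]
      by (simp add: set_integral_add dev_integrable f ft set_integrable_const_bbox)
    also have "dev \<beta> (\<lambda>y. f (y + ?e)) ?b z d = dev \<beta> f ?b (z + ?e) d"
      unfolding dev_def by (rule bbox_translate_integral)
    also have "dev \<beta> f ?a z d + dev \<beta> f ?b (z + ?e) d + d powr s * cmod (?a - ?b) \<le>
        A * d powr p + A * d powr p + d powr s * ((t / d powr \<beta> $ i + 1) * (2 * A * K powr p * d powr \<alpha>))"
    proof (intro add_mono mult_left_mono)
      show "dev \<beta> f (avg \<beta> f z d) z d \<le> A * d powr p" for z
        using osc_le_iff[OF d] A[OF d] by blast
      then show "dev \<beta> f ?b (z + ?e) d \<le> A * d powr p" .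
      show "cmod (?a - ?b) \<le> (t / d powr \<beta> $ i + 1) * (2 * A * K powr p * d powr \<alpha>)"
        by (rule average_axis[OF f A d t])
    qed simp
    also have "\<dots> = d powr s * (2 * A * d powr \<alpha> + 2 * A * K powr p * (d powr \<alpha> + t * d powr (\<alpha> - \<beta> $ i)))"
      using d by (simp add: powr_add powr_diff field_simps)
    finally show ?thesis .
  qed
  let ?G = "\<lambda>d. 2 ^ CARD('n) * l powr s * (2 * A * d powr \<alpha> + 2 * A * K powr p * (d powr \<alpha> + t * d powr (\<alpha> - \<beta> $ i)))"
  have est: "(LINT y:B x l|lebesgue. cmod (f y - f (y + ?e))) \<le> ?G d" if d: "0 < d" "d \<le> l" for d
  proof -
    have "(LINT y:B x l|lebesgue. cmod (f y - f (y + ?e))) \<le> 2 ^ CARD('n) * (l / d) powr s *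
      (d powr s * (2 * A * d powr \<alpha> + 2 * A * K powr p * (d powr \<alpha> + t * d powr (\<alpha> - \<beta> $ i))))"
    proof (rule cover_integral[OF d _ _ cell[OF d(1)]])
      show "set_integrable lebesgue (B x l) (\<lambda>y. cmod (f y - f (y + ?e)))" for x l
        using dev_integrable[OF df, of \<beta> x l 0] by simp
    qed simp
    then show ?thesis
      using d l by (simp add: powr_divide)
  qed
  have a0: "\<alpha> > 0"
    using i beta_pos[of i] by linarith
  have pow: "((\<lambda>d. d powr c) \<longlongrightarrow> 0) (at_right (0::real))" if "c > 0" for c
  proof -
    have "((\<lambda>d. d powr c) \<longlongrightarrow> 0 powr c) (at_right (0::real))"
      using that by (intro tendsto_powr' tendsto_intros) (auto simp: eventually_at_right_field intro!: exI[of _ 1])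
    then show ?thesis
      using that by simp
  qed
  have "(?G \<longlongrightarrow> 2 ^ CARD('n) * l powr s * (2 * A * 0 + 2 * A * K powr p * (0 + t * 0))) (at_right 0)"
    using i a0 by (intro tendsto_intros pow) auto
  moreover have "\<forall>\<^sub>F d in at_right 0. (LINT y:B x l|lebesgue. cmod (f y - f (y + ?e))) \<le> ?G d"
    unfolding eventually_at_right_field using l est by (intro exI[of _ l]) auto
  ultimately show ?thesis
    using tendsto_lowerbound[of ?G _ "at_right 0"] by simp
qed

text \<open>The oscillation over a box is the same as over its translates in direction \<open>i\<close>, and these tend to 0.\<close>

lemma VMO_osc_eq_0:
  assumes f: "f \<in> VMO \<beta> \<alpha>" and i: "\<beta> $ i < \<alpha>" and l: "l > 0"
  shows "osc \<beta> \<alpha> f (B x l) = 0"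
proof -
  have f_loc: "locally_integrable f"
    by (rule VMO_loc[OF f])
  obtain A where A: "\<And>x l. l > 0 \<Longrightarrow> osc \<beta> \<alpha> f (B x l) \<le> A"
    using BMO_bounded[OF VMO_BMO[OF f]] by blast
  have "osc \<beta> \<alpha> f (B x l) \<le> \<epsilon>" if \<epsilon>: "\<epsilon> > 0" for \<epsilon>
  proof -
    have "\<epsilon> / 2 > 0"
      using \<epsilon> by simp
    from VMO_far[OF f this l, of x] obtain \<rho> where \<rho>: "\<rho> > 0"
      "\<And>t. \<rho> \<le> norm t \<Longrightarrow> osc \<beta> \<alpha> f (B (x + t) l) \<le> \<epsilon> / 2"
      by blast
    let ?e = "\<rho> *\<^sub>R axis i 1 :: real ^ 'n"
    let ?a = "avg \<beta> f (x + ?e) l"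
    have "osc \<beta> \<alpha> f (B (x + ?e) l) \<le> \<epsilon> / 2"
      using \<rho> by simp
    then have dev: "dev \<beta> f ?a (x + ?e) l \<le> \<epsilon> / 2 * l powr p"
      using osc_le_iff[OF l] by blast
    have ft: "locally_integrable (\<lambda>y. f (y + ?e))"
      by (rule locally_integrable_translate[OF f_loc])
    have int: "set_integrable lebesgue (B x l) (\<lambda>y. cmod (f y - f (y + ?e)))"
      using dev_integrable[OF locally_integrable_diff[OF f_loc ft], of \<beta> x l 0] by simp
    have "dev \<beta> f ?a x l \<le> (LINT y:B x l|lebesgue. cmod (f y - f (y + ?e)) + cmod (f (y + ?e) - ?a))"
      unfolding dev_def
      by (intro set_integral_mono dev_integrable f_loc set_integral_add int ft)
        (rule norm_diff_triangle_le[OF order_refl order_refl])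
    also have "\<dots> = (LINT y:B x l|lebesgue. cmod (f y - f (y + ?e))) + dev \<beta> (\<lambda>y. f (y + ?e)) ?a x l"
      unfolding dev_def by (intro set_integral_add int dev_integrable ft)
    also have "dev \<beta> (\<lambda>y. f (y + ?e)) ?a x l = dev \<beta> f ?a (x + ?e) l"
      unfolding dev_def by (rule bbox_translate_integral)
    also have "(LINT y:B x l|lebesgue. cmod (f y - f (y + ?e))) + dev \<beta> f ?a (x + ?e) l \<le> 0 + \<epsilon> / 2 * l powr p"
      using \<rho> by (intro add_mono dev translation_invariant[OF f_loc A i _ l]) auto
    finally have "osc \<beta> \<alpha> f (B x l) \<le> 2 * (\<epsilon> / 2)"
      by (intro osc_le_of_dev[OF f_loc l]) simp
    then show ?thesis
      by simp
  qed
  then have "osc \<beta> \<alpha> f (B x l) \<le> 0"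
    using field_le_epsilon[of "osc \<beta> \<alpha> f (B x l)" 0] by simp
  then show ?thesis
    using osc_nonneg[of \<beta> \<alpha> f "B x l"] by linarith
qed

end

section \<open>Density of the test functions\<close>

lemma CMO_I:
  fixes \<beta> :: "real ^ 'n"
  assumes "f \<in> BMO \<beta> \<alpha>"
    and "\<And>\<epsilon>. \<epsilon> > 0 \<Longrightarrow> \<exists>g. test_function g \<and> bmo_norm \<beta> \<alpha> (\<lambda>x. f x - g x) \<le> ennreal \<epsilon>"
  shows "f \<in> CMO \<beta> \<alpha>"
proof -
  have "\<exists>g. test_function g \<and> bmo_norm \<beta> \<alpha> (\<lambda>x. f x - g x) \<le> ennreal (1 / real (Suc j))" for j
    by (rule assms(2)) simp
  then obtain g where g: "\<And>j. test_function (g j)"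
    "\<And>j. bmo_norm \<beta> \<alpha> (\<lambda>x. f x - g j x) \<le> ennreal (1 / real (Suc j))"
    by metis
  have "(\<lambda>j. ennreal (1 / real (Suc j))) \<longlonglongrightarrow> ennreal 0"
    by (intro tendsto_ennrealI LIMSEQ_inverse_real_of_nat[unfolded inverse_eq_divide])
  then have upper: "(\<lambda>j. ennreal (1 / real (Suc j))) \<longlonglongrightarrow> 0"
    by simp
  have "(\<lambda>j. bmo_norm \<beta> \<alpha> (\<lambda>x. f x - g j x)) \<longlonglongrightarrow> 0"
    by (rule tendsto_sandwich[OF _ _ tendsto_const upper]) (simp_all add: g(2) del: of_nat_Suc)
  then have "\<exists>g. (\<forall>j. test_function (g j)) \<and> (\<lambda>j. bmo_norm \<beta> \<alpha> (\<lambda>x. f x - g j x)) \<longlonglongrightarrow> 0"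
    using g(1) by (intro exI[of _ g]) simp
  then show ?thesis
    using assms(1) by (simp add: CMO_def)
qed

theorem theorem1p34:
  fixes \<beta> :: "real ^ 'n" and \<alpha> :: real
  assumes "\<And>j. \<beta> $ j > 0" and "\<alpha> \<ge> 0"
  shows "VMO \<beta> \<alpha> \<subseteq> CMO \<beta> \<alpha>"
proof
  fix f assume f: "f \<in> VMO \<beta> \<alpha>"
  interpret exponents \<beta> \<alpha>
    by unfold_locales (fact assms)+
  have f_loc: "locally_integrable f"
    by (rule VMO_loc[OF f])
  show "f \<in> CMO \<beta> \<alpha>"
  proof (rule CMO_I[OF VMO_BMO[OF f]])
    fix \<epsilon> :: real assume \<epsilon>: "\<epsilon> > 0"
    show "\<exists>g. test_function g \<and> bmo_norm \<beta> \<alpha> (\<lambda>x. f x - g x) \<le> ennreal \<epsilon>"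
    proof (cases "\<alpha> \<le> minexp \<beta>")
      case False
      then obtain i where i: "\<beta> $ i < \<alpha>"
        using minexp_attained by (metis not_le)
      have "continuously_differentiable k (\<lambda>x :: real ^ 'n. 0 :: complex)" for k
        by (induction k) (auto simp: frechet_derivative_const)
      then have "test_function (\<lambda>x :: real ^ 'n. 0)"
        by (simp add: test_function_def)
      moreover have "bmo_norm \<beta> \<alpha> (\<lambda>x. f x - 0) \<le> ennreal \<epsilon>"
        using VMO_osc_eq_0[OF f i] \<epsilon> by (intro bmo_norm_le) simp
      ultimately show ?thesis
        by blast
    next
      case True
      interpret low_exponents \<beta> \<alpha>
        by unfold_locales (fact True)
      obtain C where C0: "C \<ge> 0" and C: "\<And>g d0 N \<epsilon>. \<lbrakk>integrable lebesgue g; N > 0;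
          \<And>x. x \<notin> bbox \<beta> 0 N \<Longrightarrow> g x = 0; d0 > 0; \<epsilon> \<ge> 0;
          \<And>x l. \<lbrakk>0 < l; l \<le> d0\<rbrakk> \<Longrightarrow> osc \<beta> \<alpha> g (bbox \<beta> x l) \<le> \<epsilon>\<rbrakk> \<Longrightarrow>
          \<exists>h. test_function h \<and> (\<forall>x l. l > 0 \<longrightarrow> osc \<beta> \<alpha> (\<lambda>x. g x - h x) (bbox \<beta> x l) \<le> C * \<epsilon>)"
        by (rule mollify) blast
      define D where "D = cutoff_const"
      have D0: "D > 0"
        unfolding D_def by (rule cutoff_const_pos)
      \<comment> \<open>Cutting off costs \<open>D * \<eta>\<close> and leaves small-box oscillations of at most \<open>(1 + D) * \<eta>\<close>, of which
        mollification costs \<open>C\<close> times as much.\<close>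
      define \<eta> where "\<eta> = \<epsilon> / (D + C * (1 + D))"
      have den: "D + C * (1 + D) > 0"
        using D0 C0 by (intro add_pos_nonneg) auto
      then have \<eta>: "\<eta> > 0"
        using \<epsilon> by (simp add: \<eta>_def)
      obtain M where M: "M > 0" "\<And>x l. l > 0 \<Longrightarrow> \<not> bbox \<beta> x l \<subseteq> bbox \<beta> 0 M \<Longrightarrow> osc \<beta> \<alpha> f (bbox \<beta> x l) \<le> \<eta>"
        using VMO_compact[OF f \<eta>] by blast
      obtain d where d: "d > 0" "\<And>x l. 0 < l \<Longrightarrow> l \<le> d \<Longrightarrow> osc \<beta> \<alpha> f (bbox \<beta> x l) \<le> \<eta>"
        using VMO_small[OF f \<eta>] by blast
      obtain g N where g: "N > 0" "integrable lebesgue g" "\<And>x. x \<notin> bbox \<beta> 0 N \<Longrightarrow> g x = 0"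
        and fg: "\<And>x l. l > 0 \<Longrightarrow> osc \<beta> \<alpha> (\<lambda>x. f x - g x) (bbox \<beta> x l) \<le> D * \<eta>"
        using cutoff[OF f_loc M(1) less_imp_le[OF \<eta>] M(2)] unfolding D_def by blast
      have g_loc: "locally_integrable g"
        by (rule locally_integrable_integrable[OF g(2)])
      note fg_loc = locally_integrable_diff[OF f_loc g_loc]
      have g_small: "osc \<beta> \<alpha> g (bbox \<beta> x l) \<le> (1 + D) * \<eta>" if "0 < l" "l \<le> d" for x l
        using osc_diff_le[OF f_loc fg_loc that(1), of x] fg[OF that(1), of x] d(2)[OF that, of x]
        by (simp add: distrib_right)
      have "(1 + D) * \<eta> \<ge> 0"
        using D0 \<eta> by simp
      from C[OF g(2,1,3) d(1) this g_small] obtain h where h: "test_function h"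
        and gh: "\<And>x l. l > 0 \<Longrightarrow> osc \<beta> \<alpha> (\<lambda>x. g x - h x) (bbox \<beta> x l) \<le> C * ((1 + D) * \<eta>)"
        by blast
      have h_loc: "locally_integrable h"
      proof (rule locally_integrable_continuous)
        have "continuously_differentiable 0 h"
          using h unfolding test_function_def by blast
        then show "continuous_on UNIV h"
          by simp
      qed
      have "osc \<beta> \<alpha> (\<lambda>x. f x - h x) (bbox \<beta> x l) \<le> \<epsilon>" if l: "l > 0" for x l
      proof -
        have hg: "osc \<beta> \<alpha> (\<lambda>x. h x - g x) (bbox \<beta> x l) = osc \<beta> \<alpha> (\<lambda>x. g x - h x) (bbox \<beta> x l)"
          using osc_minus[of \<beta> \<alpha> "\<lambda>x. g x - h x" "bbox \<beta> x l"] by simp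
        have "osc \<beta> \<alpha> (\<lambda>x. f x - h x) (bbox \<beta> x l) \<le> D * \<eta> + C * ((1 + D) * \<eta>)"
          using osc_diff_le[OF fg_loc locally_integrable_diff[OF h_loc g_loc] l, of x] fg[OF l, of x] gh[OF l, of x] hg
          by simp
        also have "\<dots> = (D + C * (1 + D)) * \<eta>"
          by (simp add: algebra_simps)
        also have "\<dots> = \<epsilon>"
          using den by (simp add: \<eta>_def)
        finally show ?thesis .
      qed
      then have "bmo_norm \<beta> \<alpha> (\<lambda>x. f x - h x) \<le> ennreal \<epsilon>"
        by (rule bmo_norm_le)
      with h show ?thesis
        by blast
    qed
  qed
qed

end
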